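(* Let $\mathbb{F}$ be an algebraically closed field. For any tensor $T\in\mathbb{F}^{n_1\times n_2\times n_3}$, $\underline{Q}(T)\le \mathrm{GR}(T)$.
   Context: For $T\in\mathbb{F}^{n_1\times n_2\times n_3}$ write $T(x,y,z)=\sum_{i,j,k}T_{i,j,k}x_iy_jz_k$ and $T(x,y,\cdot)=(T(x,y,e_k))_k$. The geometric rank is $\mathrm{GR}(T)=\operatorname{codim}\{(x,y)\in\mathbb{F}^{n_1}\times\mathbb{F}^{n_2}: T(x,y,\cdot)=0\}$ (i.e. $n_1+n_2$ minus the dimension of this affine variety). For matrices $A,B,C$ set $(A,B,C)\cdot T=(\sum_{a,b,c}A_{ia}B_{jb}C_{kc}T_{a,b,c})_{i,j,k}$. We write $S\unlhd T$ if for some $e\in\mathbb{N}$ there are tensors $S_1,\dots,S_e$ over $\mathbb{F}$ and matrices $A(\varepsilon),B(\varepsilon),C(\varepsilon)$ with entries Laurent polynomials in a formal variable $\varepsilon$ such that $S+\varepsilon S_1+\dots+\varepsilon^eS_e=(A(\varepsilon),B(\varepsilon),C(\varepsilon))\cdot T$. $I_n$ is the $n\times n\times n$ diagonal tensor with ones on the diagonal, and the border subrank is $\underline{Q}(T)=\max\{n\in\mathbb{N}: I_n\unlhd T\}$. *)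

theory Defs
  imports
    "HOL-Library.FuncSet"
    "HOL-Library.Extended_Nat"
    "HOL-Computational_Algebra.Computational_Algebra"
begin

section \<open>Affine varieties and their dimension\<close>

definition affine_space :: "'i set \<Rightarrow> ('i \<Rightarrow> 'a) set" where
  "affine_space I = (I \<rightarrow>\<^sub>E UNIV)"

inductive_set polynomial_functions :: "'i set \<Rightarrow> (('i \<Rightarrow> 'a::comm_ring_1) \<Rightarrow> 'a) set"
  for I :: "'i set" where
  const: "(\<lambda>_. c) \<in> polynomial_functions I"
| coord: "i \<in> I \<Longrightarrow> (\<lambda>z. z i) \<in> polynomial_functions I"
| add: "p \<in> polynomial_functions I \<Longrightarrow> q \<in> polynomial_functions I \<Longrightarrow>
    (\<lambda>z. p z + q z) \<in> polynomial_functions I"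
| mult: "p \<in> polynomial_functions I \<Longrightarrow> q \<in> polynomial_functions I \<Longrightarrow>
    (\<lambda>z. p z * q z) \<in> polynomial_functions I"

definition zariski_closed :: "'i set \<Rightarrow> ('i \<Rightarrow> 'a::comm_ring_1) set \<Rightarrow> bool" where
  "zariski_closed I V \<longleftrightarrow>
    (\<exists>P \<subseteq> polynomial_functions I. V = {z \<in> affine_space I. \<forall>p\<in>P. p z = 0})"

definition irreducible_closed :: "'i set \<Rightarrow> ('i \<Rightarrow> 'a::comm_ring_1) set \<Rightarrow> bool" where
  "irreducible_closed I V \<longleftrightarrow> zariski_closed I V \<and> V \<noteq> {} \<and>
    (\<forall>V1 V2. zariski_closed I V1 \<longrightarrow> zariski_closed I V2 \<longrightarrow> V = V1 \<union> V2 \<longrightarrow> V = V1 \<or> V = V2)"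

text \<open>
  The dimension of a variety is the supremum of the lengths \<open>d\<close> of chains
  \<open>Z 0 \<subset> Z 1 \<subset> \<dots> \<subset> Z d\<close> of irreducible closed subsets. It is taken in the extended naturals,
  so that no boundedness is presupposed. (The empty variety would get dimension 0, but the
  variety used below always contains the origin.)
\<close>

definition variety_dim :: "'i set \<Rightarrow> ('i \<Rightarrow> 'a::comm_ring_1) set \<Rightarrow> enat" where
  "variety_dim I V = Sup {enat d |d. \<exists>Z :: nat \<Rightarrow> ('i \<Rightarrow> 'a) set.
      (\<forall>k\<le>d. irreducible_closed I (Z k) \<and> Z k \<subseteq> V) \<and> (\<forall>k<d. Z k \<subset> Z (Suc k))}"

section \<open>Tensors and geometric rank\<close>

text \<open>
  A tensor of format \<open>n1 \<times> n2 \<times> n3\<close> is a function of three indices; only its values at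
  \<open>i < n1\<close>, \<open>j < n2\<close>, \<open>k < n3\<close> are ever used. Matrices are treated in the same way.
\<close>

type_synonym 'a tensor = "nat \<Rightarrow> nat \<Rightarrow> nat \<Rightarrow> 'a"

definition tensor_form ::
    "nat \<Rightarrow> nat \<Rightarrow> nat \<Rightarrow> 'a::comm_ring_1 tensor \<Rightarrow> (nat \<Rightarrow> 'a) \<Rightarrow> (nat \<Rightarrow> 'a) \<Rightarrow> (nat \<Rightarrow> 'a) \<Rightarrow> 'a" where
  "tensor_form n1 n2 n3 T x y z = (\<Sum>i<n1. \<Sum>j<n2. \<Sum>k<n3. T i j k * x i * y j * z k)"

definition std_basis :: "nat \<Rightarrow> nat \<Rightarrow> 'a::comm_ring_1" where
  "std_basis k = (\<lambda>l. if l = k then 1 else 0)"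

text \<open>
  The product of the affine spaces of dimensions \<open>n1\<close> and \<open>n2\<close> is the affine space with coordinates
  indexed by the disjoint sum \<open>{..<n1} <+> {..<n2}\<close>: a point \<open>w\<close> is the pair of vectors
  \<open>x = w \<circ> Inl\<close> and \<open>y = w \<circ> Inr\<close>.
\<close>

definition kernel_variety :: "nat \<Rightarrow> nat \<Rightarrow> nat \<Rightarrow> 'a::comm_ring_1 tensor \<Rightarrow> (nat + nat \<Rightarrow> 'a) set" where
  "kernel_variety n1 n2 n3 T = {w \<in> affine_space ({..<n1} <+> {..<n2}).
      \<forall>k<n3. tensor_form n1 n2 n3 T (w \<circ> Inl) (w \<circ> Inr) (std_basis k) = 0}"

definition geometric_rank :: "nat \<Rightarrow> nat \<Rightarrow> nat \<Rightarrow> 'a::comm_ring_1 tensor \<Rightarrow> enat" where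
  "geometric_rank n1 n2 n3 T =
    enat (n1 + n2) - variety_dim ({..<n1} <+> {..<n2}) (kernel_variety n1 n2 n3 T)"

section \<open>Degeneration and border subrank\<close>

definition tensor_action ::
    "nat \<Rightarrow> nat \<Rightarrow> nat \<Rightarrow> (nat \<Rightarrow> nat \<Rightarrow> 'a::comm_ring_1) \<Rightarrow> (nat \<Rightarrow> nat \<Rightarrow> 'a) \<Rightarrow> (nat \<Rightarrow> nat \<Rightarrow> 'a) \<Rightarrow>
     'a tensor \<Rightarrow> 'a tensor" where
  "tensor_action n1 n2 n3 A B C T =
    (\<lambda>i j k. \<Sum>a<n1. \<Sum>b<n2. \<Sum>c<n3. A i a * B j b * C k c * T a b c)"

definition laurent_polynomials :: "'a::comm_ring_1 fls set" where
  "laurent_polynomials = {f. finite {n. fls_nth f n \<noteq> 0}}"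

text \<open>\<open>degenerates m1 m2 m3 S n1 n2 n3 T\<close> is \<open>S \<unlhd> T\<close>, where \<open>S\<close> has format \<open>m1 \<times> m2 \<times> m3\<close>.\<close>

definition degenerates ::
    "nat \<Rightarrow> nat \<Rightarrow> nat \<Rightarrow> 'a::comm_ring_1 tensor \<Rightarrow> nat \<Rightarrow> nat \<Rightarrow> nat \<Rightarrow> 'a tensor \<Rightarrow> bool" where
  "degenerates m1 m2 m3 S n1 n2 n3 T \<longleftrightarrow>
    (\<exists>(e::nat) (R :: nat \<Rightarrow> 'a tensor) A B C.
      (\<forall>i<m1. \<forall>a<n1. A i a \<in> laurent_polynomials) \<and>
      (\<forall>j<m2. \<forall>b<n2. B j b \<in> laurent_polynomials) \<and>
      (\<forall>k<m3. \<forall>c<n3. C k c \<in> laurent_polynomials) \<and>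
      (\<forall>i<m1. \<forall>j<m2. \<forall>k<m3.
        fls_const (S i j k) + (\<Sum>d=1..e. fls_X ^ d * fls_const (R d i j k)) =
        tensor_action n1 n2 n3 A B C (\<lambda>a b c. fls_const (T a b c)) i j k))"

definition unit_tensor :: "'a::comm_ring_1 tensor" where
  "unit_tensor = (\<lambda>i j k. if i = j \<and> j = k then 1 else 0)"

text \<open>
  Over a field, the set below contains 0 and is bounded by \<open>min n1 (min n2 n3)\<close>, so the maximum exists.
\<close>

definition border_subrank :: "nat \<Rightarrow> nat \<Rightarrow> nat \<Rightarrow> 'a::comm_ring_1 tensor \<Rightarrow> nat" where
  "border_subrank n1 n2 n3 T = Max {n. degenerates n n n unit_tensor n1 n2 n3 T}"

end

theory Submission
  imports
    Defs
    "HOL-Library.Function_Algebras"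
    "Jordan_Normal_Form.Determinant"
begin

text \<open>
  Suppose the unit tensor of size \<open>n\<close> is a degeneration of \<open>T\<close>. Clearing denominators and specialising
  \<open>\<epsilon>\<close> to a nonzero \<open>t\<close>, the linear map \<open>u \<mapsto> (A(t)\<^sup>T u, B(t)\<^sup>T u)\<close> pulls suitable combinations of the
  slices of \<open>T\<close> back to the quadrics \<open>u\<^sub>k\<^sup>2 + t (\<dots>)\<close>. By the pigeonhole principle every word of length
  \<open>n + 1\<close> in the \<open>u\<^sub>i\<close> contains a square, so modulo these quadrics the words satisfy a linear system
  that is the identity at \<open>t = 0\<close>, and hence invertible for all but finitely many \<open>t\<close>. For such a \<open>t\<close>
  the image of the map is an \<open>n\<close>-dimensional subspace meeting the kernel variety only in the origin,
  and, choosing at most \<open>n1 + n2 - n\<close> complementary coordinates \<open>l\<^sub>j\<close>, the functions on the kernel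
  variety form a module over the polynomials in the \<open>l\<^sub>j\<close> that is spanned by the words of length at
  most \<open>n\<close>. On the other hand, a chain of \<open>d\<close> strict inclusions of irreducible closed sets yields
  functions \<open>h\<^sub>0, \<dots>, h\<^sub>d\<^sub>-\<^sub>1\<close>, with \<open>h\<^sub>k\<close> vanishing on the \<open>k\<close>-th set but not on the next one, whose
  monomials are linearly independent. Counting dimensions gives \<open>d \<le> n1 + n2 - n\<close>.
\<close>

section \<open>Clearing denominators\<close>

text \<open>Once the pole is cleared, finite support makes the series a polynomial. Stating this for
  all large \<open>m\<close> lets the finitely many entries of a matrix share one exponent.\<close>

lemma eventually_laurent_polynomial_shift:
  assumes "f \<in> laurent_polynomials"
  shows "\<forall>\<^sub>F m in sequentially. \<exists>p. fls_X ^ m * f = fps_to_fls (fps_of_poly p)"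
  unfolding eventually_sequentially
proof (rule exI, intro allI impI)
  fix m :: nat assume m: "nat (- fls_subdegree f) \<le> m"
  define K where "K = {k::nat. fls_nth f (int k - int m) \<noteq> 0}"
  have "finite ((\<lambda>k. int k - int m) -` {k. fls_nth f k \<noteq> 0})"
    using assms by (intro finite_vimageI) (auto simp: laurent_polynomials_def inj_def)
  then have fin: "finite K"
    by (simp add: K_def vimage_def)
  define p where "p = (\<Sum>k\<in>K. monom (fls_nth f (int k - int m)) k)"
  have coeff_p: "coeff p k = fls_nth f (int k - int m)" for k
    using fin by (auto simp: p_def coeff_sum K_def)
  have "fls_X ^ m * f = fps_to_fls (fps_of_poly p)"
  proof (rule fls_eqI)
    fix k :: int
    show "fls_nth (fls_X ^ m * f) k = fls_nth (fps_to_fls (fps_of_poly p)) k"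
    proof (cases "k < 0")
      case True
      then show ?thesis
        using m by (simp add: fls_X_power_times_conv_shift)
    next
      case False
      then show ?thesis
        by (simp add: fls_X_power_times_conv_shift coeff_p)
    qed
  qed
  then show "\<exists>p. fls_X ^ m * f = fps_to_fls (fps_of_poly p)" ..
qed

lemma laurent_matrix_clear_denominators:
  fixes A :: "nat \<Rightarrow> nat \<Rightarrow> 'a::comm_ring_1 fls"
  assumes "\<forall>i<m. \<forall>a<n. A i a \<in> laurent_polynomials"
  obtains M P where "\<And>i a. i < m \<Longrightarrow> a < n \<Longrightarrow> fls_X ^ M * A i a = fps_to_fls (fps_of_poly (P i a))"
proof -
  have "\<forall>\<^sub>F M in sequentially. \<forall>i\<in>{..<m}. \<forall>a\<in>{..<n}. \<exists>p. fls_X ^ M * A i a = fps_to_fls (fps_of_poly p)"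
    using assms by (intro eventually_ball_finite ballI eventually_laurent_polynomial_shift) auto
  then obtain M where "\<forall>i\<in>{..<m}. \<forall>a\<in>{..<n}. \<exists>p. fls_X ^ M * A i a = fps_to_fls (fps_of_poly p)"
    by (auto simp: eventually_sequentially)
  then have "\<forall>i a. \<exists>p. i < m \<longrightarrow> a < n \<longrightarrow> fls_X ^ M * A i a = fps_to_fls (fps_of_poly p)"
    by auto
  then show thesis
    using that by metis
qed

lemma fps_to_fls_sum: "fps_to_fls (\<Sum>x\<in>S. f x) = (\<Sum>x\<in>S. fps_to_fls (f x))"
  by (induction S rule: infinite_finite_induct) auto

text \<open>After clearing denominators both sides are images of polynomials. The embedding of
  polynomials into Laurent series is injective, so the identity holds between polynomials and can be
  evaluated at every \<open>t\<close>.\<close>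

lemma degenerates_polynomial_family:
  fixes S T :: "'a::comm_ring_1 tensor"
  assumes "degenerates m1 m2 m3 S n1 n2 n3 T"
  obtains M :: nat and A B C :: "nat \<Rightarrow> nat \<Rightarrow> 'a poly" and R :: "nat \<Rightarrow> nat \<Rightarrow> nat \<Rightarrow> 'a poly"
  where "\<forall>t. \<forall>i<m1. \<forall>j<m2. \<forall>k<m3.
    tensor_action n1 n2 n3 (\<lambda>i a. poly (A i a) t) (\<lambda>j b. poly (B j b) t) (\<lambda>k c. poly (C k c) t) T i j k =
    t ^ M * (S i j k + t * poly (R i j k) t)"
proof -
  obtain e R A B C where
    A: "\<forall>i<m1. \<forall>a<n1. A i a \<in> laurent_polynomials" and
    B: "\<forall>j<m2. \<forall>b<n2. B j b \<in> laurent_polynomials" and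
    C: "\<forall>k<m3. \<forall>c<n3. C k c \<in> laurent_polynomials" and
    eq: "\<forall>i<m1. \<forall>j<m2. \<forall>k<m3.
        fls_const (S i j k) + (\<Sum>d=1..e. fls_X ^ d * fls_const (R d i j k)) =
        tensor_action n1 n2 n3 A B C (\<lambda>a b c. fls_const (T a b c)) i j k"
    using assms unfolding degenerates_def by (elim exE conjE) (rule that)
  obtain MA PA where PA: "\<And>i a. i < m1 \<Longrightarrow> a < n1 \<Longrightarrow> fls_X ^ MA * A i a = fps_to_fls (fps_of_poly (PA i a))"
    using laurent_matrix_clear_denominators[OF A] by blast
  obtain MB PB where PB: "\<And>i a. i < m2 \<Longrightarrow> a < n2 \<Longrightarrow> fls_X ^ MB * B i a = fps_to_fls (fps_of_poly (PB i a))"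
    using laurent_matrix_clear_denominators[OF B] by blast
  obtain MC PC where PC: "\<And>i a. i < m3 \<Longrightarrow> a < n3 \<Longrightarrow> fls_X ^ MC * C i a = fps_to_fls (fps_of_poly (PC i a))"
    using laurent_matrix_clear_denominators[OF C] by blast
  \<comment> \<open>Here \<open>d \<ge> 1\<close>, so \<open>d - 1\<close> does not truncate:
    exactly one factor \<open>t\<close> is taken out of each error term.\<close>
  define R' where "R' i j k = (\<Sum>d=1..e. monom (R d i j k) (d - 1))" for i j k
  let ?\<phi> = "\<lambda>p. fps_to_fls (fps_of_poly p)"
  have regroup: "x * y * z * (a * b * c * w) = (x * a) * (y * b) * (z * c) * w"
    for x y z a b c w :: "'a fls"
    by (simp add: algebra_simps)
  have phi_mult: "?\<phi> (p * q) = ?\<phi> p * ?\<phi> q" for p q :: "'a poly"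
    by (simp add: fps_of_poly_mult fls_times_fps_to_fls)
  have phi_const: "?\<phi> [:c:] = fls_const c" for c :: 'a
    by (simp add: fps_of_poly_const)
  have phi_X: "?\<phi> (monom c d) = fls_X ^ d * fls_const c" for c :: 'a and d
    by (simp add: fps_of_poly_monom fls_times_fps_to_fls fps_to_fls_power mult.commute)
  have poly_eq: "monom 1 (MA + MB + MC) * ([:S i j k:] + (\<Sum>d=1..e. monom (R d i j k) d)) =
      (\<Sum>a<n1. \<Sum>b<n2. \<Sum>c<n3. PA i a * PB j b * PC k c * [:T a b c:])"
    if ijk: "i < m1" "j < m2" "k < m3" for i j k
  proof -
    have "?\<phi> (monom 1 (MA + MB + MC) * ([:S i j k:] + (\<Sum>d=1..e. monom (R d i j k) d)))
      = fls_X ^ (MA + MB + MC) * (fls_const (S i j k) + (\<Sum>d=1..e. fls_X ^ d * fls_const (R d i j k)))"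
      by (simp only: phi_mult phi_X phi_const fps_of_poly_add fps_of_poly_sum fps_to_fls_sum
          fps_to_fls_plus fls_const_1 mult_1_right)
    also have "\<dots> = fls_X ^ (MA + MB + MC) *
        tensor_action n1 n2 n3 A B C (\<lambda>a b c. fls_const (T a b c)) i j k"
      using eq ijk by simp
    also have "\<dots> = (\<Sum>a<n1. \<Sum>b<n2. \<Sum>c<n3.
        (fls_X ^ MA * A i a) * (fls_X ^ MB * B j b) * (fls_X ^ MC * C k c) * fls_const (T a b c))"
      unfolding tensor_action_def sum_distrib_left power_add
      by (intro sum.cong refl regroup)
    also have "\<dots> = (\<Sum>a<n1. \<Sum>b<n2. \<Sum>c<n3.
        ?\<phi> (PA i a) * ?\<phi> (PB j b) * ?\<phi> (PC k c) * fls_const (T a b c))"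
      using ijk by (intro sum.cong refl) (simp add: PA PB PC)
    also have "\<dots> = ?\<phi> (\<Sum>a<n1. \<Sum>b<n2. \<Sum>c<n3. PA i a * PB j b * PC k c * [:T a b c:])"
      by (simp only: phi_mult phi_const fps_of_poly_sum fps_to_fls_sum)
    finally show ?thesis
      by (simp only: fps_to_fls_eq_iff fps_of_poly_eq_iff)
  qed
  show thesis
  proof (rule that, intro allI impI)
    fix t i j k assume ijk: "i < m1" "j < m2" "k < m3"
    have "(\<Sum>d=1..e. R d i j k * t ^ d) = t * poly (R' i j k) t"
      unfolding R'_def poly_sum sum_distrib_left
      by (rule sum.cong) (auto simp: poly_monom Suc_le_eq gr0_conv_Suc)
    then have "poly (monom 1 (MA + MB + MC) * ([:S i j k:] + (\<Sum>d=1..e. monom (R d i j k) d))) t =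
        t ^ (MA + MB + MC) * (S i j k + t * poly (R' i j k) t)"
      by (simp add: poly_sum poly_monom)
    then show "tensor_action n1 n2 n3 (\<lambda>i a. poly (PA i a) t) (\<lambda>j b. poly (PB j b) t)
        (\<lambda>k c. poly (PC k c) t) T i j k = t ^ (MA + MB + MC) * (S i j k + t * poly (R' i j k) t)"
      unfolding poly_eq[OF ijk] tensor_action_def
      by (simp only: poly_sum poly_mult poly_pCons poly_0 mult_zero_right add_0_right)
  qed
qed

section \<open>Words of length \<open>n + 1\<close>\<close>

text \<open>\<open>D\<close> is the determinant and \<open>G\<close> the adjugate, both available
  over the polynomial ring. Evaluation at 0 commutes with the determinant and turns the matrix into
  the identity, so \<open>D\<close> is a nonzero polynomial.\<close>

lemma polynomial_matrix_adjugate: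
  fixes A :: "'b \<Rightarrow> 'b \<Rightarrow> 'a::idom poly"
  assumes fin: "finite W"
    and A0: "\<And>x y. x \<in> W \<Longrightarrow> y \<in> W \<Longrightarrow> poly (A x y) 0 = (if x = y then 1 else 0)"
  obtains D :: "'a poly" and G where "poly D 0 = 1"
    "\<And>x z. x \<in> W \<Longrightarrow> z \<in> W \<Longrightarrow> (\<Sum>y\<in>W. G x y * A y z) = (if x = z then D else 0)"
proof -
  define N where "N = card W"
  obtain f where f: "bij_betw f {0..<N} W"
    using ex_bij_betw_nat_finite[OF fin] unfolding N_def by blast
  define g where "g = the_inv_into {0..<N} f"
  have g: "g x < N" "f (g x) = x" if "x \<in> W" for x
    using f that the_inv_into_into[of f "{0..<N}" x "{0..<N}"] f_the_inv_into_f[of f "{0..<N}" x]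
    by (auto simp: bij_betw_def g_def simp del: the_inv_into_into)
  define B where "B = mat N N (\<lambda>(i, j). A (f i) (f j))"
  have B: "B \<in> carrier_mat N N"
    by (simp add: B_def)
  interpret ev: comm_ring_hom "\<lambda>p::'a poly. poly p 0"
    by unfold_locales auto
  have "poly (det B) 0 = det (map_mat (\<lambda>p. poly p 0) B)"
    by simp
  also have "map_mat (\<lambda>p. poly p 0) B = 1\<^sub>m N"
    using f by (intro eq_matI) (auto simp: B_def A0 bij_betw_def inj_on_def)
  finally have D0: "poly (det B) 0 = 1"
    by simp
  define G where "G x y = adj_mat B $$ (g x, g y)" for x y
  have "(\<Sum>y\<in>W. G x y * A y z) = (if x = z then det B else 0)" if "x \<in> W" "z \<in> W" for x z
  proof -
    have gf: "g (f j) = j" if "j < N" for j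
      using f that by (auto simp: g_def bij_betw_def the_inv_into_f_f)
    have "(\<Sum>y\<in>W. G x y * A y z) = (\<Sum>j\<in>{0..<N}. G x (f j) * A (f j) z)"
      using sum.reindex_bij_betw[OF f, of "\<lambda>y. G x y * A y z"] by simp
    also have "\<dots> = (adj_mat B * B) $$ (g x, g z)"
      using g[OF that(1)] g[OF that(2)] adj_mat(1)[OF B] 
      by (auto simp: B_def scalar_prod_def G_def gf intro!: sum.cong)
    also have "\<dots> = (det B \<cdot>\<^sub>m 1\<^sub>m N) $$ (g x, g z)"
      by (simp add: adj_mat(3)[OF B])
    also have "\<dots> = (if x = z then det B else 0)"
      using g[OF that(1)] g[OF that(2)] by auto
    finally show ?thesis .
  qed
  then show thesis
    using that D0 by blast
qed

text \<open>In a finite field, the product of all \<open>[:- a, 1:]\<close> plus 1 has positive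
  degree but takes the value 1 everywhere. Infinity of the field leaves room to avoid finitely many
  bad \<open>t\<close>.\<close>

lemma infinite_UNIV_alg_closed_field: "infinite (UNIV :: 'a::alg_closed_field set)"
proof
  assume fin: "finite (UNIV :: 'a set)"
  define p :: "'a poly" where "p = (\<Prod>a\<in>UNIV. [:- a, 1:])"
  have "degree p = card (UNIV :: 'a set)"
    unfolding p_def by (subst degree_prod_eq_sum_degree) auto
  then have "degree (p + 1) > 0"
    using fin by (subst degree_add_eq_left) (auto simp: card_gt_0_iff)
  then obtain x where "poly (p + 1) x = 0"
    using alg_closed_imp_poly_has_root by blast
  moreover have "poly p x = 0"
    using fin by (auto simp: p_def poly_prod)
  ultimately show False
    by simp
qed

text \<open>Words are lists, so two of them may be the same monomial; they serve only as spanning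
  elements and as indices of equations, where repetition does no harm.\<close>

definition word :: "(nat \<Rightarrow> 'a::comm_ring_1) \<Rightarrow> nat list \<Rightarrow> 'a" where
  "word u xs = prod_list (map u xs)"

lemma word_Nil [simp]: "word u [] = 1"
  and word_Cons [simp]: "word u (x # xs) = u x * word u xs"
  by (simp_all add: word_def)

text \<open>Some letter repeats, and deleting two copies of it leaves \<open>n - 1\<close> letters.
  The letter and the remainder are chosen before \<open>u\<close>, so they serve all
  \<open>u\<close> at once.\<close>

lemma word_square_decomp:
  assumes "set xs \<subseteq> {..<n}" "length xs = Suc n"
  shows "\<exists>k<n. \<exists>ys. set ys \<subseteq> {..<n} \<and> Suc (length ys) = n \<and>
    (\<forall>u :: nat \<Rightarrow> 'a::comm_ring_1. word u xs = u k ^ 2 * word u ys)"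
proof -
  have "\<not> distinct xs"
  proof
    assume "distinct xs"
    then have "card (set xs) = Suc n"
      using assms by (simp add: distinct_card)
    moreover have "card (set xs) \<le> card {..<n}"
      by (rule card_mono) (use assms in auto)
    ultimately show False
      by simp
  qed
  then obtain as bs cs k where xs: "xs = as @ [k] @ bs @ [k] @ cs"
    using not_distinct_decomp by blast
  show ?thesis
    using assms unfolding xs
    by (intro exI[of _ k] conjI exI[of _ "as @ bs @ cs"])
       (auto simp: word_def power2_eq_square mult_ac)
qed

text \<open>Replacing the square in a word by its quadratic relation gives \<open>\<delta> k\<close>
  times the shorter word minus \<open>t\<close> times a combination of words
  \<open>i # j # rest xs\<close>, which again have length \<open>n + 1\<close>. The system is thus
  square, and the adjugate solves it. It is applied with \<open>\<delta> = 0\<close> to get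
  injectivity, and with error terms on the kernel variety.\<close>

lemma word_linear_system:
  fixes R :: "nat \<Rightarrow> nat \<Rightarrow> nat \<Rightarrow> 'a::idom poly" and n :: nat
  defines "W \<equiv> {xs. set xs \<subseteq> {..<n} \<and> length xs = Suc n}"
  obtains D :: "'a poly" and G :: "nat list \<Rightarrow> nat list \<Rightarrow> 'a poly" and
    key :: "nat list \<Rightarrow> nat" and rest :: "nat list \<Rightarrow> nat list" where
    "poly D 0 = 1"
    "\<forall>xs\<in>W. key xs < n"
    "\<forall>xs\<in>W. set (rest xs) \<subseteq> {..<n} \<and> Suc (length (rest xs)) = n"
    "\<forall>t u \<delta>. (\<forall>k<n. u k ^ 2 + t * (\<Sum>i<n. \<Sum>j<n. poly (R i j k) t * u i * u j) = \<delta> k) \<longrightarrow>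
      (\<forall>xs\<in>W. poly D t * word u xs =
        (\<Sum>ys\<in>W. poly (G xs ys) t * (\<delta> (key ys) * word u (rest ys))))"
proof -
  have "\<exists>k ys. xs \<in> W \<longrightarrow> k < n \<and> set ys \<subseteq> {..<n} \<and> Suc (length ys) = n \<and>
    (\<forall>u :: nat \<Rightarrow> 'a. word u xs = u k ^ 2 * word u ys)" for xs
    using word_square_decomp[of xs n, where 'a='a] unfolding W_def by auto
  then obtain key rest where kr: "\<And>xs. xs \<in> W \<Longrightarrow> key xs < n \<and> set (rest xs) \<subseteq> {..<n} \<and>
      Suc (length (rest xs)) = n \<and> (\<forall>u :: nat \<Rightarrow> 'a. word u xs = u (key xs) ^ 2 * word u (rest xs))"
    by metis
  have fin: "finite W"
    unfolding W_def by (rule finite_lists_length_eq) simp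
  \<comment> \<open>The factor \<open>[:0, 1:]\<close> is the variable, so the matrix is the
    identity at 0. The double sum picks the one pair \<open>i\<close>, \<open>j\<close>, if any,
    that leads from \<open>xs\<close> to \<open>ys\<close>.\<close>
  define A where "A xs ys = (if xs = ys then 1 else 0) + [:0, 1:] *
    (\<Sum>i<n. \<Sum>j<n. if i # j # rest xs = ys then R i j (key xs) else 0)" for xs ys
  obtain D G where D0: "poly D 0 = 1" and
    DG: "\<And>x z. x \<in> W \<Longrightarrow> z \<in> W \<Longrightarrow> (\<Sum>y\<in>W. G x y * A y z) = (if x = z then D else 0)"
    by (rule polynomial_matrix_adjugate[OF fin, of A]) (auto simp: A_def)
  show thesis
  proof (rule that[of D key rest G]; (intro allI impI ballI)?)
    fix t u \<delta> xs
    assume rel: "\<forall>k<n. u k ^ 2 + t * (\<Sum>i<n. \<Sum>j<n. poly (R i j k) t * u i * u j) = \<delta> k" and xs: "xs \<in> W"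
    have row: "(\<Sum>zs\<in>W. poly (A ys zs) t * word u zs) = \<delta> (key ys) * word u (rest ys)"
      if ys: "ys \<in> W" for ys
    proof -
      have inner: "(\<Sum>zs\<in>W. poly (if i # j # rest ys = zs then R i j (key ys) else 0) t * word u zs)
          = poly (R i j (key ys)) t * (u i * (u j * word u (rest ys)))" if "i < n" "j < n" for i j
      proof -
        have "i # j # rest ys \<in> W"
          using kr[OF ys] that by (auto simp: W_def)
        have "(\<Sum>zs\<in>W. poly (if i # j # rest ys = zs then R i j (key ys) else 0) t * word u zs)
          = (\<Sum>zs\<in>W. if i # j # rest ys = zs then poly (R i j (key ys)) t * word u zs else 0)"
          by (intro sum.cong) auto
        then show ?thesis
          using \<open>i # j # rest ys \<in> W\<close> fin by simp
      qed
      have "(\<Sum>zs\<in>W. poly (A ys zs) t * word u zs) =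
          (\<Sum>zs\<in>W. if ys = zs then word u zs else 0) + t * (\<Sum>zs\<in>W. \<Sum>i<n. \<Sum>j<n.
            poly (if i # j # rest ys = zs then R i j (key ys) else 0) t * word u zs)"
        unfolding sum_distrib_left sum.distrib[symmetric]
        by (intro sum.cong refl)
           (auto simp: A_def poly_sum sum_distrib_left sum_distrib_right algebra_simps)
      also have "(\<Sum>zs\<in>W. if ys = zs then word u zs else 0) = word u ys"
        using ys fin by simp
      also have "(\<Sum>zs\<in>W. \<Sum>i<n. \<Sum>j<n.
            poly (if i # j # rest ys = zs then R i j (key ys) else 0) t * word u zs) =
          (\<Sum>i<n. \<Sum>j<n. \<Sum>zs\<in>W.
            poly (if i # j # rest ys = zs then R i j (key ys) else 0) t * word u zs)"
        by (subst sum.swap) (intro sum.cong refl sum.swap)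
      also have "\<dots> = (\<Sum>i<n. \<Sum>j<n. poly (R i j (key ys)) t * (u i * (u j * word u (rest ys))))"
        by (intro sum.cong refl inner) auto
      also have "word u ys + t * \<dots> = (u (key ys) ^ 2 +
          t * (\<Sum>i<n. \<Sum>j<n. poly (R i j (key ys)) t * u i * u j)) * word u (rest ys)"
        using kr[OF ys] by (simp add: ring_distribs sum_distrib_right sum_distrib_left mult_ac)
      also have "\<dots> = \<delta> (key ys) * word u (rest ys)"
        using kr[OF ys] rel by simp
      finally show ?thesis .
    qed
    \<comment> \<open>The equations \<open>row\<close> are combined with the coefficients
      \<open>G xs ys\<close>; by the adjugate identity only the word \<open>xs\<close>
      survives.\<close>
    have "(\<Sum>ys\<in>W. poly (G xs ys) t * (\<delta> (key ys) * word u (rest ys))) =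
        (\<Sum>ys\<in>W. \<Sum>zs\<in>W. poly (G xs ys * A ys zs) t * word u zs)"
      by (intro sum.cong refl) (simp add: row[symmetric] sum_distrib_left mult_ac)
    also have "\<dots> = (\<Sum>zs\<in>W. poly (\<Sum>ys\<in>W. G xs ys * A ys zs) t * word u zs)"
      by (subst sum.swap) (simp add: poly_sum sum_distrib_right)
    also have "\<dots> = (\<Sum>zs\<in>W. if xs = zs then poly D t * word u zs else 0)"
      by (intro sum.cong refl) (simp add: DG[OF xs])
    also have "\<dots> = poly D t * word u xs"
      using xs fin by simp
    finally show "poly D t * word u xs =
        (\<Sum>ys\<in>W. poly (G xs ys) t * (\<delta> (key ys) * word u (rest ys)))" ..
  qed (use D0 kr in auto)
qed

section \<open>Linear algebra in spaces of functions\<close>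

interpretation funs: vector_space "\<lambda>(c::'a::field) (f::'p \<Rightarrow> 'a) p. c * f p"
  by unfold_locales (auto simp: algebra_simps)

lemma sum_fun_apply: "(\<Sum>x\<in>A. f x) p = (\<Sum>x\<in>A. f x p)" for f :: "'b \<Rightarrow> 'p \<Rightarrow> 'a::comm_monoid_add"
  by (induction A rule: infinite_finite_induct) auto

lemma independent_family:
  fixes m :: "'b \<Rightarrow> 'p \<Rightarrow> 'a::field"
  assumes fin: "finite A"
    and ind: "\<And>c. (\<And>p. (\<Sum>a\<in>A. c a * m a p) = 0) \<Longrightarrow> \<forall>a\<in>A. c a = 0"
  shows "inj_on m A" "funs.independent (m ` A)"
proof -
  show inj: "inj_on m A"
  proof (rule inj_onI, rule ccontr)
    fix a b assume ab: "a \<in> A" "b \<in> A" "m a = m b" "a \<noteq> b"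
    \<comment> \<open>Equal functions at two distinct indices would give a relation with
      coefficients 1 and -1.\<close>
    define c where "c x = (if x = a then 1 else if x = b then - 1 else 0 :: 'a)" for x
    have "(\<Sum>x\<in>A. c x * m x p) = 0" for p
    proof -
      have "(\<Sum>x\<in>A. c x * m x p) = (\<Sum>x\<in>{a, b}. c x * m x p)"
        using fin ab by (intro sum.mono_neutral_right) (auto simp: c_def)
      then show ?thesis
        using ab by (simp add: c_def)
    qed
    then have "c a = 0"
      using ind ab by blast
    then show False
      by (simp add: c_def)
  qed
  show "funs.independent (m ` A)"
  proof (rule funs.independent_if_scalars_zero)
    show "finite (m ` A)"
      using fin by simp
    fix f x assume sum0: "(\<Sum>x\<in>m ` A. (\<lambda>p. f x * x p)) = 0" and x: "x \<in> m ` A"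
    have "(\<Sum>a\<in>A. f (m a) * m a p) = 0" for p
      using fun_cong[OF sum0, of p] inj by (simp add: sum_fun_apply sum.reindex)
    then show "f x = 0"
      using ind[of "\<lambda>a. f (m a)"] x by auto
  qed
qed

text \<open>Steinitz exchange: the vectors \<open>E i\<close> are completed to a basis by unit
  vectors, and \<open>J\<close> indexes those added. Everything lies in the span of the unit vectors
  of \<open>I\<close>, whence the count.\<close>

lemma unit_vector_complement:
  fixes E :: "nat \<Rightarrow> 'i \<Rightarrow> 'a::field"
  assumes fin: "finite I"
    and supp: "\<And>i x. i < n \<Longrightarrow> x \<notin> I \<Longrightarrow> E i x = 0"
    and ind: "\<And>u. (\<And>x. (\<Sum>i<n. u i * E i x) = 0) \<Longrightarrow> \<forall>i<n. u i = 0"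
  obtains J where "J \<subseteq> I" "card J + n \<le> card I"
    "\<forall>w. \<exists>u l. \<forall>x\<in>I. w x = (\<Sum>i<n. u i * E i x) + (if x \<in> J then l x else 0)"
proof -
  define d where "d j = (\<lambda>x. if x = j then 1 else 0 :: 'a)" for j :: 'i
  define S where "S = E ` {..<n}"
  define T where "T = d ` I"
  have inj_d: "inj d"
    by (rule injI) (metis d_def zero_neq_one)
  have S: "inj_on E {..<n}" "funs.independent S"
    unfolding S_def using ind by (intro independent_family; auto)+
  obtain B where B: "S \<subseteq> B" "B \<subseteq> S \<union> T" "funs.independent B" "S \<union> T \<subseteq> funs.span B"
    using funs.maximal_independent_subset_extend[of S "S \<union> T"] S by blast
  have expand: "w = (\<Sum>j\<in>I. (\<lambda>x. w j * d j x))" if "\<And>x. x \<notin> I \<Longrightarrow> w x = 0" for w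
    using fin that
    by (auto simp: fun_eq_iff sum_fun_apply d_def if_distrib[of "(*) c" for c] cong: if_cong)
  have T_span: "w \<in> funs.span T" if "\<And>x. x \<notin> I \<Longrightarrow> w x = 0" for w
  proof -
    have "(\<Sum>j\<in>I. (\<lambda>x. w j * d j x)) \<in> funs.span T"
      by (intro funs.span_sum funs.span_scale funs.span_base) (auto simp: T_def)
    moreover have "(\<Sum>j\<in>I. (\<lambda>x. w j * d j x)) = w"
      by (rule expand[symmetric]) (rule that)
    ultimately show ?thesis
      by (simp only:)
  qed
  have "B \<subseteq> funs.span T"
  proof -
    have "S \<subseteq> funs.span T"
      using supp by (auto simp: S_def intro!: T_span)
    then show ?thesis
      using B(2) funs.span_superset[of T] by blast
  qed
  then have "finite B" and cardB: "card B \<le> card T"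
    using funs.independent_span_bound[of T B] B(3) fin by (auto simp: T_def)
  \<comment> \<open>A unit vector that is itself some \<open>E i\<close> already belongs to
    \<open>S\<close>; removing \<open>S\<close> keeps it from being counted twice.\<close>
  define J where "J = {j \<in> I. d j \<in> B - S}"
  have BS: "B - S = d ` J"
    using B(2) by (auto simp: J_def T_def)
  show thesis
  proof (rule that)
    show "J \<subseteq> I"
      by (auto simp: J_def)
    have "card J = card (B - S)"
      unfolding BS using inj_on_subset[OF inj_d subset_UNIV] by (simp add: card_image)
    also have "\<dots> = card B - card S"
      using B(1) \<open>finite B\<close> by (simp add: card_Diff_subset finite_subset)
    finally have "card J + n = card B"
      using card_mono[OF \<open>finite B\<close> B(1)] S(1) by (simp add: S_def card_image)
    also have "\<dots> \<le> card I"
      using cardB card_image_le[OF fin, of d] by (simp add: T_def)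
    finally show "card J + n \<le> card I" .
    show "\<forall>w. \<exists>u l. \<forall>x\<in>I. w x = (\<Sum>i<n. u i * E i x) + (if x \<in> J then l x else 0)"
    proof
      fix w :: "'i \<Rightarrow> 'a"
      define w' where "w' x = (if x \<in> I then w x else 0)" for x
      have "w' \<in> funs.span T"
        by (rule T_span) (simp add: w'_def)
      also have "funs.span T \<subseteq> funs.span B"
        using B(4) by (intro funs.span_minimal) auto
      finally obtain c where "w' = (\<Sum>v\<in>B. (\<lambda>x. c v * v x))"
        unfolding funs.span_finite[OF \<open>finite B\<close>] by auto
      then have c: "w' x = (\<Sum>v\<in>B. c v * v x)" for x
        by (simp add: sum_fun_apply)
      have "w x = (\<Sum>i<n. c (E i) * E i x) + (if x \<in> J then c (d x) else 0)" if "x \<in> I" for x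
      proof -
        have "w x = (\<Sum>v\<in>S. c v * v x) + (\<Sum>v\<in>B - S. c v * v x)"
          using that c[of x] sum.subset_diff[OF B(1) \<open>finite B\<close>, of "\<lambda>v. c v * v x"]
          by (simp add: w'_def add.commute)
        also have "(\<Sum>v\<in>S. c v * v x) = (\<Sum>i<n. c (E i) * E i x)"
          unfolding S_def using S(1) by (simp add: sum.reindex)
        also have "(\<Sum>v\<in>B - S. c v * v x) = (\<Sum>j\<in>J. if x = j then c (d j) else 0)"
          unfolding BS sum.reindex[OF inj_on_subset[OF inj_d subset_UNIV]]
          by (auto simp: d_def intro!: sum.cong)
        also have "\<dots> = (if x \<in> J then c (d x) else 0)"
          using fin by (simp add: J_def)
        finally show ?thesis .
      qed
      then show "\<exists>u l. \<forall>x\<in>I. w x = (\<Sum>i<n. u i * E i x) + (if x \<in> J then l x else 0)"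
        by (intro exI[of _ "\<lambda>i. c (E i)"] exI[of _ "\<lambda>x. c (d x)"]) auto
    qed
  qed
qed

section \<open>The filtered module spanned by words\<close>

lemma span_mult_closed:
  fixes f q :: "'p \<Rightarrow> 'a::field"
  assumes "\<And>g. g \<in> S \<Longrightarrow> (\<lambda>p. f p * g p) \<in> funs.span S'" and "q \<in> funs.span S"
  shows "(\<lambda>p. f p * q p) \<in> funs.span S'"
  using assms(2)
proof (induction rule: funs.span_induct_alt)
  case base
  have "(\<lambda>p. f p * (0 :: 'p \<Rightarrow> 'a) p) = 0"
    by (simp add: fun_eq_iff)
  then show ?case
    using funs.span_zero by metis
next
  case (step c x y)
  have "(\<lambda>p. c * (f p * x p)) + (\<lambda>p. f p * y p) \<in> funs.span S'"
    using step assms(1) by (intro funs.span_add funs.span_scale) auto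
  moreover have "(\<lambda>p. c * (f p * x p)) + (\<lambda>p. f p * y p) = (\<lambda>p. f p * ((\<lambda>p. c * x p) + y) p)"
    by (simp add: fun_eq_iff algebra_simps)
  ultimately show ?case
    by simp
qed

text \<open>The \<open>u i\<close> are the letters and the \<open>l j\<close> the parameters, all
  functions on an arbitrary type of points. Relations between them enter later as hypotheses of
  single lemmas.\<close>

locale word_module =
  fixes n :: nat and u :: "nat \<Rightarrow> 'p \<Rightarrow> 'a::field" and J :: "'j set" and l :: "'j \<Rightarrow> 'p \<Rightarrow> 'a"
  assumes finite_J: "finite J"
begin

text \<open>Each exponent is bounded separately, so there are exactly
  \<open>(b + 1) ^ card J\<close> exponent vectors. The number of words does not depend on
  \<open>b\<close>, so \<open>card J\<close> governs the growth.\<close>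

definition gens :: "nat \<Rightarrow> ('p \<Rightarrow> 'a) set" where
  "gens b = (\<lambda>(s, e) p. word (\<lambda>i. u i p) s * (\<Prod>j\<in>J. l j p ^ e j)) `
    ({s. set s \<subseteq> {..<n} \<and> length s \<le> n} \<times> (J \<rightarrow>\<^sub>E {..b}))"

abbreviation filt :: "nat \<Rightarrow> ('p \<Rightarrow> 'a) set" where
  "filt b \<equiv> funs.span (gens b)"

lemma gensI:
  "set s \<subseteq> {..<n} \<Longrightarrow> length s \<le> n \<Longrightarrow> e \<in> J \<rightarrow>\<^sub>E {..b} \<Longrightarrow>
    (\<lambda>p. word (\<lambda>i. u i p) s * (\<Prod>j\<in>J. l j p ^ e j)) \<in> gens b"
  unfolding gens_def by (rule image_eqI[of _ _ "(s, e)"]) auto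

lemma finite_gens: "finite (gens b)"
  and card_gens: "card (gens b) \<le> card {s. set s \<subseteq> {..<n} \<and> length s \<le> n} * (b + 1) ^ card J"
proof -
  have fin: "finite ({s. set s \<subseteq> {..<n} \<and> length s \<le> n} \<times> (J \<rightarrow>\<^sub>E {..b}))"
    using finite_J by (intro finite_cartesian_product finite_lists_length_le finite_PiE) auto
  then show "finite (gens b)"
    by (simp add: gens_def)
  have "card (J \<rightarrow>\<^sub>E {..b}) = (b + 1) ^ card J"
    using finite_J by (simp add: card_PiE)
  then show "card (gens b) \<le> card {s. set s \<subseteq> {..<n} \<and> length s \<le> n} * (b + 1) ^ card J"
    using card_image_le[OF fin] unfolding gens_def card_cartesian_product by simp
qed

lemma filt_mono: "b \<le> b' \<Longrightarrow> filt b \<subseteq> filt b'"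
  unfolding gens_def by (intro funs.span_mono image_mono Sigma_mono PiE_mono) auto

lemma word_in_filt:
  assumes "set s \<subseteq> {..<n}" "length s \<le> n"
  shows "(\<lambda>p. word (\<lambda>i. u i p) s) \<in> filt b"
proof -
  have "(\<lambda>p. word (\<lambda>i. u i p) s * (\<Prod>j\<in>J. l j p ^ restrict (\<lambda>_. 0) J j)) \<in> filt b"
    using assms by (intro funs.span_base gensI) auto
  then show ?thesis
    by simp
qed

lemma monomial_mult_filt:
  assumes e: "e \<in> J \<rightarrow>\<^sub>E {..a}" and q: "q \<in> filt b"
  shows "(\<lambda>p. (\<Prod>j\<in>J. l j p ^ e j) * q p) \<in> filt (a + b)"
proof (rule span_mult_closed[OF _ q])
  fix g assume "g \<in> gens b"
  then obtain s e' where s: "set s \<subseteq> {..<n}" "length s \<le> n" and e': "e' \<in> J \<rightarrow>\<^sub>E {..b}"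
    and g: "g = (\<lambda>p. word (\<lambda>i. u i p) s * (\<Prod>j\<in>J. l j p ^ e' j))"
    by (auto simp: gens_def)
  have "(\<lambda>p. word (\<lambda>i. u i p) s * (\<Prod>j\<in>J. l j p ^ restrict (\<lambda>j. e j + e' j) J j)) \<in> filt (a + b)"
    using e e' by (intro funs.span_base gensI s) (auto simp: PiE_iff extensional_def intro!: add_mono)
  then show "(\<lambda>p. (\<Prod>j\<in>J. l j p ^ e j) * g p) \<in> filt (a + b)"
    by (simp add: g power_add prod.distrib mult_ac)
qed

lemma parameter_mult_filt:
  assumes j: "j \<in> J" and q: "q \<in> filt b"
  shows "(\<lambda>p. l j p * q p) \<in> filt (b + 1)"
proof -
  define e where "e = restrict (\<lambda>i. if i = j then 1 else 0 :: nat) J"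
  have "(\<Prod>i\<in>J. l i p ^ e i) = (\<Prod>i\<in>J. if i = j then l i p else 1)" for p
    by (intro prod.cong) (auto simp: e_def)
  then have "(\<Prod>i\<in>J. l i p ^ e i) = l j p" for p
    using j finite_J by simp
  then show ?thesis
    using monomial_mult_filt[of e 1 q b, OF _ q] by (simp add: e_def add.commute)
qed

lemma filt_sum: "(\<And>x. x \<in> A \<Longrightarrow> f x \<in> filt b) \<Longrightarrow> (\<lambda>p. \<Sum>x\<in>A. f x p) \<in> filt b"
  unfolding sum_fun_apply[symmetric] by (rule funs.span_sum)

lemma filt_scale: "f \<in> filt b \<Longrightarrow> (\<lambda>p. c * f p) \<in> filt b"
  by (rule funs.span_scale)

lemma filt_add: "f \<in> filt b \<Longrightarrow> g \<in> filt b \<Longrightarrow> (\<lambda>p. f p + g p) \<in> filt b"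
  using funs.span_add[of f "gens b" g] by (simp add: plus_fun_def)

lemma filt_zero: "(\<lambda>p. 0) \<in> filt b"
  using funs.span_zero[of "gens b"] by (simp add: zero_fun_def)

lemma optional_parameter_mult_filt:
  "q \<in> filt b \<Longrightarrow> (\<lambda>p. (if j \<in> J then l j p else 0) * q p) \<in> filt (b + 1)"
  using parameter_mult_filt[of j q b] by (cases "j \<in> J") (auto simp: filt_zero)

text \<open>There is room for one more letter, so the level does not rise. The words left after
  removing a square have such a length.\<close>

lemma linear_mult_word_filt:
  assumes "set s \<subseteq> {..<n}" "length s < n"
  shows "(\<lambda>p. (\<Sum>i<n. c i * u i p) * word (\<lambda>i. u i p) s) \<in> filt b"
proof -
  have "(\<lambda>p. \<Sum>i<n. c i * word (\<lambda>i. u i p) (i # s)) \<in> filt b"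
    using assms by (intro filt_sum filt_scale word_in_filt) auto
  then show ?thesis
    by (simp only: sum_distrib_right word_Cons mult.assoc)
qed

text \<open>A word with fewer than \<open>n\<close> letters takes another one for free; a word with
  \<open>n\<close> letters reaches length \<open>n + 1\<close>, where \<open>top\<close> rewrites it
  at a cost of 2.\<close>

lemma letter_mult_filt:
  assumes top: "\<And>s. set s \<subseteq> {..<n} \<Longrightarrow> length s = Suc n \<Longrightarrow> (\<lambda>p. word (\<lambda>i. u i p) s) \<in> filt 2"
    and i: "i < n" and q: "q \<in> filt b"
  shows "(\<lambda>p. u i p * q p) \<in> filt (b + 2)"
proof (rule span_mult_closed[OF _ q])
  fix g assume "g \<in> gens b"
  then obtain s e where s: "set s \<subseteq> {..<n}" "length s \<le> n" and e: "e \<in> J \<rightarrow>\<^sub>E {..b}"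
    and g: "g = (\<lambda>p. word (\<lambda>i. u i p) s * (\<Prod>j\<in>J. l j p ^ e j))"
    by (auto simp: gens_def)
  have "(\<lambda>p. word (\<lambda>i. u i p) (i # s)) \<in> filt 2"
    using s i top[of "i # s"] word_in_filt[of "i # s"] by (cases "length s = n") auto
  from monomial_mult_filt[OF e this]
  show "(\<lambda>p. u i p * g p) \<in> filt (b + 2)"
    by (simp add: g mult_ac)
qed

text \<open>The shift \<open>e\<close> depends on \<open>h\<close> but not on \<open>b\<close> or
  \<open>q\<close>. Allowing an arbitrary \<open>q\<close> turns the product case into a composition
  of two multiplications.\<close>

lemma polynomial_function_mult_filt:
  fixes \<rho> :: "'p \<Rightarrow> 'i \<Rightarrow> 'a"
  assumes coord: "\<And>x. x \<in> I \<Longrightarrow> \<exists>c j. \<forall>p. \<rho> p x = (\<Sum>i<n. c i * u i p) + (if j \<in> J then l j p else 0)"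
    and top: "\<And>s. set s \<subseteq> {..<n} \<Longrightarrow> length s = Suc n \<Longrightarrow> (\<lambda>p. word (\<lambda>i. u i p) s) \<in> filt 2"
    and h: "h \<in> polynomial_functions I"
  shows "\<exists>e. \<forall>b. \<forall>q\<in>filt b. (\<lambda>p. h (\<rho> p) * q p) \<in> filt (b + e)"
  using h
proof induction
  case (const c)
  then show ?case
    by (intro exI[of _ 0]) (auto intro: filt_scale)
next
  case (coord x)
  obtain c j where cj: "\<And>p. \<rho> p x = (\<Sum>i<n. c i * u i p) + (if j \<in> J then l j p else 0)"
    using assms(1)[OF coord] by blast
  have "(\<lambda>p. \<rho> p x * q p) \<in> filt (b + 2)" if q: "q \<in> filt b" for b q
  proof -
    have "(\<lambda>p. \<Sum>i<n. c i * (u i p * q p)) \<in> filt (b + 2)"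
      using q top by (intro filt_sum filt_scale letter_mult_filt) auto
    moreover have "(\<lambda>p. (if j \<in> J then l j p else 0) * q p) \<in> filt (b + 2)"
      using optional_parameter_mult_filt[OF q, of j] filt_mono[of "b + 1" "b + 2"] by auto
    ultimately have "(\<lambda>p. (\<Sum>i<n. c i * (u i p * q p)) + (if j \<in> J then l j p else 0) * q p) \<in> filt (b + 2)"
      by (rule filt_add)
    then show ?thesis
      by (simp only: cj distrib_right sum_distrib_right mult.assoc)
  qed
  then show ?case
    by blast
next
  case (add f g)
  then obtain e1 e2 where
    e: "\<And>b q. q \<in> filt b \<Longrightarrow> (\<lambda>p. f (\<rho> p) * q p) \<in> filt (b + e1)"
       "\<And>b q. q \<in> filt b \<Longrightarrow> (\<lambda>p. g (\<rho> p) * q p) \<in> filt (b + e2)"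
    by blast
  have "(\<lambda>p. (f (\<rho> p) + g (\<rho> p)) * q p) \<in> filt (b + max e1 e2)" if "q \<in> filt b" for b q
    using e[OF that] filt_mono[of "b + e1" "b + max e1 e2"] filt_mono[of "b + e2" "b + max e1 e2"]
    by (auto simp: distrib_right intro!: filt_add)
  then show ?case
    by blast
next
  case (mult f g)
  then obtain e1 e2 where
    e: "\<And>b q. q \<in> filt b \<Longrightarrow> (\<lambda>p. f (\<rho> p) * q p) \<in> filt (b + e1)"
       "\<And>b q. q \<in> filt b \<Longrightarrow> (\<lambda>p. g (\<rho> p) * q p) \<in> filt (b + e2)"
    by blast
  have "(\<lambda>p. (f (\<rho> p) * g (\<rho> p)) * q p) \<in> filt (b + (e2 + e1))" if "q \<in> filt b" for b q
    using e(1)[OF e(2)[OF that]] by (simp add: mult.assoc add.assoc)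
  then show ?case
    by blast
qed

end

section \<open>Chains of irreducible closed sets\<close>

text \<open>This is primality of the vanishing ideal: the zero loci of \<open>f\<close> and
  \<open>g\<close> in \<open>Z\<close> are closed and cover \<open>Z\<close>.\<close>

lemma irreducible_closed_mult_eq_0:
  fixes Z :: "('i \<Rightarrow> 'a::idom) set"
  assumes Z: "irreducible_closed I Z"
    and f: "f \<in> polynomial_functions I" and g: "g \<in> polynomial_functions I"
    and fg: "\<forall>w\<in>Z. f w * g w = 0"
  shows "(\<forall>w\<in>Z. f w = 0) \<or> (\<forall>w\<in>Z. g w = 0)"
proof -
  obtain P where P: "P \<subseteq> polynomial_functions I" "Z = {z \<in> affine_space I. \<forall>p\<in>P. p z = 0}"
    using Z by (auto simp: irreducible_closed_def zariski_closed_def)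
  have cl: "zariski_closed I {w \<in> Z. h w = 0}" if "h \<in> polynomial_functions I" for h
    unfolding zariski_closed_def using P that by (intro exI[of _ "insert h P"]) auto
  have "Z = {w \<in> Z. f w = 0} \<union> {w \<in> Z. g w = 0}"
    using fg by auto
  then have "Z = {w \<in> Z. f w = 0} \<or> Z = {w \<in> Z. g w = 0}"
    using Z cl[OF f] cl[OF g] unfolding irreducible_closed_def by blast
  then show ?thesis
    by blast
qed

lemma zariski_closed_separating_function:
  assumes "zariski_closed I Y" "zariski_closed I Z" "Y \<subset> Z"
  obtains h w where "h \<in> polynomial_functions I" "\<forall>z\<in>Y. h z = 0" "w \<in> Z" "h w \<noteq> 0"
proof -
  obtain P where P: "P \<subseteq> polynomial_functions I" "Y = {z \<in> affine_space I. \<forall>p\<in>P. p z = 0}"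
    using assms(1) by (auto simp: zariski_closed_def)
  obtain w where w: "w \<in> Z" "w \<notin> Y"
    using assms(3) by blast
  moreover have "w \<in> affine_space I"
    using assms(2) w(1) by (auto simp: zariski_closed_def)
  ultimately obtain h where "h \<in> P" "h w \<noteq> 0"
    using P by blast
  then show thesis
    using that[of h w] P w by auto
qed

section \<open>Algebraic independence along a chain\<close>

lemma polynomial_functions_sum:
  "(\<And>x. x \<in> A \<Longrightarrow> f x \<in> polynomial_functions I) \<Longrightarrow>
    (\<lambda>w. \<Sum>x\<in>A. f x w) \<in> polynomial_functions I"
  by (induction A rule: infinite_finite_induct) (auto intro: polynomial_functions.intros)

lemma polynomial_functions_power:
  "f \<in> polynomial_functions I \<Longrightarrow> (\<lambda>w. f w ^ k) \<in> polynomial_functions I"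
  by (induction k) (auto intro: polynomial_functions.intros)

text \<open>A transcendence statement for \<open>h\<close>. On \<open>Y\<close> the relation reduces
  to \<open>p 0 = 0\<close>, which \<open>ext\<close> extends to all points; irreducibility of
  \<open>Z\<close> then cancels one factor \<open>h\<close>, leaving a relation of smaller
  degree.\<close>

lemma polynomial_in_function_zero_on_irreducible:
  fixes Z :: "('i \<Rightarrow> 'a::idom) set"
  assumes Z: "irreducible_closed I Z"
    and h: "h \<in> polynomial_functions I" "\<forall>w\<in>Y. h w = 0" "z \<in> Z" "h z \<noteq> 0" "Y \<subseteq> Z"
    and p: "\<And>i. i \<le> s \<Longrightarrow> p i \<in> polynomial_functions I"
    and ext: "\<And>i. i \<le> s \<Longrightarrow> (\<forall>w\<in>Y. p i w = 0) \<Longrightarrow> (\<forall>w. p i w = 0)"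
    and zero: "\<forall>w\<in>Z. (\<Sum>i\<le>s. h w ^ i * p i w) = 0"
  shows "\<forall>i\<le>s. \<forall>w. p i w = 0"
  using p ext zero
proof (induction s arbitrary: p)
  case 0
  then show ?case
    using h by auto
next
  case (Suc s)
  have split: "(\<Sum>i\<le>Suc s. h w ^ i * p i w) = p 0 w + h w * (\<Sum>i\<le>s. h w ^ i * p (Suc i) w)" for w
    by (simp only: sum.atMost_Suc_shift) (simp add: sum_distrib_left mult_ac)
  have "p 0 w = 0" if "w \<in> Y" for w
  proof -
    have "p 0 w + h w * (\<Sum>i\<le>s. h w ^ i * p (Suc i) w) = 0"
      using Suc.prems(3) that h(5) unfolding split by blast
    then show ?thesis
      using h(2) that by simp
  qed
  then have p0: "\<forall>w. p 0 w = 0"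
    using Suc.prems(2)[of 0] by simp
  have "\<forall>w\<in>Z. h w * (\<Sum>i\<le>s. h w ^ i * p (Suc i) w) = 0"
    using Suc.prems(3) p0 unfolding split by simp
  moreover have "(\<lambda>w. \<Sum>i\<le>s. h w ^ i * p (Suc i) w) \<in> polynomial_functions I"
    using h(1) Suc.prems(1)
    by (intro polynomial_functions_sum polynomial_functions.mult polynomial_functions_power) auto
  ultimately have "\<forall>w\<in>Z. (\<Sum>i\<le>s. h w ^ i * p (Suc i) w) = 0"
    using irreducible_closed_mult_eq_0[OF Z h(1)] h(3,4) by blast
  then have "\<forall>i\<le>s. \<forall>w. p (Suc i) w = 0"
    using Suc.prems by (intro Suc.IH) auto
  with p0 show ?case
    by (metis Suc_le_mono not0_implies_Suc)
qed

text \<open>The head of the list is the exponent of the function with the largest index, so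
  recursion on the list removes the top step of the chain.\<close>

primrec chain_monomial :: "(nat \<Rightarrow> 'p \<Rightarrow> 'a::comm_ring_1) \<Rightarrow> nat list \<Rightarrow> 'p \<Rightarrow> 'a" where
  "chain_monomial h [] w = 1"
| "chain_monomial h (x # xs) w = h (length xs) w ^ x * chain_monomial h xs w"

lemma chain_monomial_polynomial:
  "(\<And>k. k < length xs \<Longrightarrow> h k \<in> polynomial_functions I) \<Longrightarrow> chain_monomial h xs \<in> polynomial_functions I"
proof (induction xs)
  case Nil
  have "chain_monomial h [] = (\<lambda>_. 1)"
    by (rule ext) simp
  then show ?case
    by (simp add: polynomial_functions.const)
next
  case (Cons x xs)
  have "(\<lambda>w. h (length xs) w ^ x * chain_monomial h xs w) \<in> polynomial_functions I"
    using Cons by (intro polynomial_functions.mult polynomial_functions_power) auto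
  then show ?case
    by simp
qed

text \<open>Induction on the length of the chain. Sorted by powers of \<open>h d\<close>, the
  coefficients are combinations of monomials for the chain up to \<open>Z d\<close>. By the
  induction hypothesis such a combination vanishing on \<open>Z d\<close> is trivial, hence zero
  everywhere, so the powers of \<open>h d\<close> can be separated on
  \<open>Z (Suc d)\<close>.\<close>

lemma chain_monomials_independent:
  fixes Z :: "nat \<Rightarrow> ('i \<Rightarrow> 'a::idom) set"
  assumes irr: "\<And>k. k \<le> d \<Longrightarrow> irreducible_closed I (Z k)"
    and sub: "\<And>k. k < d \<Longrightarrow> Z k \<subseteq> Z (Suc k)"
    and h: "\<And>k. k < d \<Longrightarrow> h k \<in> polynomial_functions I \<and> (\<forall>w\<in>Z k. h k w = 0) \<and> (\<exists>w\<in>Z (Suc k). h k w \<noteq> 0)"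
    and zero: "\<forall>w\<in>Z d. (\<Sum>xs | set xs \<subseteq> {..s} \<and> length xs = d. c xs * chain_monomial h xs w) = 0"
  shows "\<forall>xs. set xs \<subseteq> {..s} \<and> length xs = d \<longrightarrow> c xs = 0"
  using irr sub h zero
proof (induction d arbitrary: c)
  case 0
  have "{xs. set xs \<subseteq> {..s} \<and> length xs = 0} = {[]}"
    by auto
  moreover have "Z 0 \<noteq> {}"
    using 0(1) by (auto simp: irreducible_closed_def)
  ultimately show ?case
    using 0(4) by auto
next
  case (Suc d)
  define L where "L = {xs::nat list. set xs \<subseteq> {..s} \<and> length xs = d}"
  define p where "p i w = (\<Sum>xs\<in>L. c (i # xs) * chain_monomial h xs w)" for i w
  have split: "(\<Sum>xs | set xs \<subseteq> {..s} \<and> length xs = Suc d. c xs * chain_monomial h xs w) =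
      (\<Sum>i\<le>s. h d w ^ i * p i w)" for w
  proof -
    have "(\<Sum>xs | set xs \<subseteq> {..s} \<and> length xs = Suc d. c xs * chain_monomial h xs w) =
      (\<Sum>(xs, i)\<in>L \<times> {..s}. c (i # xs) * (h d w ^ i * chain_monomial h xs w))"
      unfolding lists_length_Suc_eq
      by (subst sum.reindex) (auto simp: inj_on_def L_def intro!: sum.cong)
    also have "\<dots> = (\<Sum>i\<le>s. \<Sum>xs\<in>L. c (i # xs) * (h d w ^ i * chain_monomial h xs w))"
      by (subst sum.swap) (simp add: sum.cartesian_product)
    finally show ?thesis
      by (simp add: p_def sum_distrib_left mult_ac)
  qed
  have h_d: "h d \<in> polynomial_functions I" "\<forall>w\<in>Z d. h d w = 0" "\<exists>w\<in>Z (Suc d). h d w \<noteq> 0"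
    using Suc.prems(3) by auto
  have vanish: "\<forall>xs\<in>L. c (i # xs) = 0" if "\<forall>w\<in>Z d. p i w = 0" for i
    using Suc.IH[of "\<lambda>xs. c (i # xs)"] Suc.prems(1-3) that
    by (auto simp: p_def L_def le_Suc_eq less_Suc_eq)
  obtain z where z: "z \<in> Z (Suc d)" "h d z \<noteq> 0"
    using h_d(3) by blast
  have "\<forall>i\<le>s. \<forall>w. p i w = 0"
  proof (rule polynomial_in_function_zero_on_irreducible[OF _ h_d(1,2) z])
    show "irreducible_closed I (Z (Suc d))" "Z d \<subseteq> Z (Suc d)"
      using Suc.prems(1,2) by auto
    show "p i \<in> polynomial_functions I" for i
      unfolding p_def using Suc.prems(3)
      by (intro polynomial_functions_sum polynomial_functions.mult polynomial_functions.const
          chain_monomial_polynomial) (auto simp: L_def)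
    show "\<forall>w. p i w = 0" if "\<forall>w\<in>Z d. p i w = 0" for i
      using vanish[OF that] by (simp add: p_def)
    show "\<forall>w\<in>Z (Suc d). (\<Sum>i\<le>s. h d w ^ i * p i w) = 0"
      using Suc.prems(4) by (simp add: split)
  qed
  then have "\<forall>i\<le>s. \<forall>xs\<in>L. c (i # xs) = 0"
    using vanish by blast
  then show ?case
    by (auto simp: L_def length_Suc_conv)
qed

section \<open>Comparison of growth rates\<close>

lemma power_growth_exponent_le:
  fixes K c d r :: nat
  assumes "\<And>s. (s + 1) ^ d \<le> K * (c * s + 1) ^ r"
  shows "d \<le> r"
proof (rule ccontr)
  assume "\<not> d \<le> r"
  \<comment> \<open>With this \<open>s\<close>, the assumed bound yields
    \<open>(s + 1) ^ Suc r \<le> s * (s + 1) ^ r\<close>, which is absurd.\<close>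
  define s where "s = K * (c + 1) ^ r"
  have "(s + 1) ^ Suc r \<le> (s + 1) ^ d"
    using \<open>\<not> d \<le> r\<close> by (intro power_increasing) auto
  also have "\<dots> \<le> K * (c * s + 1) ^ r"
    by (rule assms)
  also have "\<dots> \<le> K * ((c + 1) * (s + 1)) ^ r"
    by (intro mult_left_mono power_mono) auto
  also have "\<dots> = s * (s + 1) ^ r"
    by (simp only: power_mult_distrib mult.assoc[symmetric] s_def[symmetric])
  finally show False
    by simp
qed

context word_module
begin

text \<open>Each multiplication by some \<open>h k\<close> costs \<open>e\<close>, and there are at
  most \<open>length xs * s\<close> of them. The level is thus linear in \<open>s\<close>, as the
  comparison of growth rates requires.\<close>

lemma chain_monomial_filt:
  fixes \<rho> :: "'p \<Rightarrow> 'i \<Rightarrow> 'a"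
  assumes h: "\<And>k b q. k < length xs \<Longrightarrow> q \<in> filt b \<Longrightarrow> (\<lambda>p. h k (\<rho> p) * q p) \<in> filt (b + e)"
    and xs: "set xs \<subseteq> {..s}"
  shows "(\<lambda>p. chain_monomial h xs (\<rho> p)) \<in> filt (length xs * (s * e))"
  using h xs
proof (induction xs)
  case Nil
  show ?case
    using word_in_filt[of "[]"] by simp
next
  case (Cons x xs)
  have IH: "(\<lambda>p. chain_monomial h xs (\<rho> p)) \<in> filt (length xs * (s * e))"
    using Cons by simp
  have "(\<lambda>p. h (length xs) (\<rho> p) ^ y * chain_monomial h xs (\<rho> p)) \<in> filt (length xs * (s * e) + y * e)" for y
  proof (induction y)
    case 0
    then show ?case
      using IH by simp
  next
    case (Suc y)
    from Cons.prems(1)[OF _ this, of "length xs"] show ?case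
      by (simp add: mult.assoc add_ac)
  qed
  from this[of x] have mem: "(\<lambda>p. chain_monomial h (x # xs) (\<rho> p)) \<in> filt (length xs * (s * e) + x * e)"
    by simp
  have "length xs * (s * e) + x * e \<le> length (x # xs) * (s * e)"
    using Cons.prems(2) by simp
  from filt_mono[OF this] mem show ?case
    by blast
qed

text \<open>The \<open>(s + 1) ^ d\<close> chain monomials with exponents at most \<open>s\<close>
  are independent and lie in a level with at most a constant times
  \<open>(d * e * s + 1) ^ card J\<close> generators. Independence is known on \<open>Z d\<close>;
  by \<open>cover\<close> it passes to the functions composed with \<open>\<rho>\<close>.\<close>

lemma chain_length_le:
  fixes Z :: "nat \<Rightarrow> ('i \<Rightarrow> 'a) set" and \<rho> :: "'p \<Rightarrow> 'i \<Rightarrow> 'a"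
  assumes coord: "\<And>x. x \<in> I \<Longrightarrow> \<exists>c j. \<forall>p. \<rho> p x = (\<Sum>i<n. c i * u i p) + (if j \<in> J then l j p else 0)"
    and top: "\<And>s. set s \<subseteq> {..<n} \<Longrightarrow> length s = Suc n \<Longrightarrow> (\<lambda>p. word (\<lambda>i. u i p) s) \<in> filt 2"
    and irr: "\<And>k. k \<le> d \<Longrightarrow> irreducible_closed I (Z k)"
    and sub: "\<And>k. k < d \<Longrightarrow> Z k \<subset> Z (Suc k)"
    and cover: "Z d \<subseteq> range \<rho>"
  shows "d \<le> card J"
proof -
  have "\<exists>h. k < d \<longrightarrow> h \<in> polynomial_functions I \<and> (\<forall>w\<in>Z k. h w = 0) \<and> (\<exists>w\<in>Z (Suc k). h w \<noteq> 0)" for k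
  proof (cases "k < d")
    case True
    then have "zariski_closed I (Z k)" "zariski_closed I (Z (Suc k))" "Z k \<subset> Z (Suc k)"
      using irr[of k] irr[of "Suc k"] sub by (auto simp: irreducible_closed_def)
    then show ?thesis
      using zariski_closed_separating_function by metis
  qed auto
  then obtain h where h: "\<And>k. k < d \<Longrightarrow>
      h k \<in> polynomial_functions I \<and> (\<forall>w\<in>Z k. h k w = 0) \<and> (\<exists>w\<in>Z (Suc k). h k w \<noteq> 0)"
    by metis
  define mult_bound where "mult_bound k e \<longleftrightarrow>
    (\<forall>b. \<forall>q\<in>filt b. (\<lambda>p. h k (\<rho> p) * q p) \<in> filt (b + e))" for k e
  have "\<exists>e. mult_bound k e" if "k < d" for k
    unfolding mult_bound_def
    by (rule polynomial_function_mult_filt[where I = I and \<rho> = \<rho>, OF coord top])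
       (use h[OF that] in simp_all)
  then obtain E where "\<And>k. k < d \<Longrightarrow> mult_bound k (E k)"
    by metis
  then have E: "(\<lambda>p. h k (\<rho> p) * q p) \<in> filt (b + E k)" if "k < d" "q \<in> filt b" for k b q
    using that unfolding mult_bound_def by simp
  define e where "e = (\<Sum>k<d. E k)"
  have e: "(\<lambda>p. h k (\<rho> p) * q p) \<in> filt (b + e)" if "k < d" "q \<in> filt b" for k b q
  proof -
    have "E k \<le> e"
      using that(1) unfolding e_def by (intro member_le_sum) auto
    then show ?thesis
      using E[OF that] filt_mono[of "b + E k" "b + e"] by auto
  qed
  have "(s + 1) ^ d \<le> card {s. set s \<subseteq> {..<n} \<and> length s \<le> n} * (d * e * s + 1) ^ card J" for s
  proof -
    define X where "X = {xs::nat list. set xs \<subseteq> {..s} \<and> length xs = d}"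
    define m where "m xs p = chain_monomial h xs (\<rho> p)" for xs p
    have fin: "finite X"
      unfolding X_def by (rule finite_lists_length_eq) simp
    have ind: "\<forall>xs\<in>X. c xs = 0" if "\<And>p. (\<Sum>xs\<in>X. c xs * m xs p) = 0" for c
    proof -
      have "\<forall>w\<in>Z d. (\<Sum>xs\<in>X. c xs * chain_monomial h xs w) = 0"
        using cover that unfolding m_def by auto
      then show ?thesis
        using chain_monomials_independent[of d I Z h c s, OF irr _ h] sub unfolding X_def by auto
    qed
    have "m ` X \<subseteq> filt (d * e * s)"
    proof (rule image_subsetI)
      fix xs assume "xs \<in> X"
      then have "set xs \<subseteq> {..s}" "length xs = d"
        by (simp_all add: X_def)
      then show "m xs \<in> filt (d * e * s)"
        using chain_monomial_filt[of xs h \<rho> e s] e by (simp add: m_def[abs_def] mult_ac)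
    qed
    moreover have indep: "inj_on m X" "funs.independent (m ` X)"
      using independent_family[where m = m, OF fin ind] by simp_all
    ultimately have "card (m ` X) \<le> card (gens (d * e * s))"
      using funs.independent_span_bound[OF finite_gens] by blast
    moreover have "card (m ` X) = (s + 1) ^ d"
      using indep(1) by (simp add: card_image X_def card_lists_length_eq)
    ultimately show ?thesis
      using card_gens[of "d * e * s"] by simp
  qed
  then show ?thesis
    by (rule power_growth_exponent_le)
qed

end

section \<open>The kernel variety\<close>

definition bilinear_value ::
    "nat \<Rightarrow> nat \<Rightarrow> nat \<Rightarrow> 'a::comm_ring_1 tensor \<Rightarrow> (nat \<Rightarrow> 'a) \<Rightarrow> (nat \<Rightarrow> 'a) \<Rightarrow> (nat \<Rightarrow> 'a) \<Rightarrow> 'a" where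
  "bilinear_value n1 n2 n3 T z x y = (\<Sum>a<n1. \<Sum>b<n2. \<Sum>c<n3. z c * T a b c * (x a * y b))"

text \<open>Every extra term is written with a factor from the increments \<open>x'\<close>,
  \<open>y'\<close>, which will be the parameters.\<close>

lemma bilinear_value_add:
  "bilinear_value n1 n2 n3 T z (\<lambda>a. x a + x' a) (\<lambda>b. y b + y' b) =
    bilinear_value n1 n2 n3 T z x y + (\<Sum>a<n1. \<Sum>b<n2. \<Sum>c<n3.
      z c * T a b c * (y' b * x a + x' a * y b + x' a * y' b))"
  unfolding bilinear_value_def sum.distrib[symmetric]
  by (intro sum.cong refl) (simp add: algebra_simps)

lemma bilinear_value_cong:
  "(\<And>a. a < n1 \<Longrightarrow> x a = x' a) \<Longrightarrow> (\<And>b. b < n2 \<Longrightarrow> y b = y' b) \<Longrightarrow>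
    bilinear_value n1 n2 n3 T z x y = bilinear_value n1 n2 n3 T z x' y'"
  unfolding bilinear_value_def by (intro sum.cong) auto

text \<open>By linearity in \<open>z\<close>, vanishing of the slices passes to all their
  combinations.\<close>

lemma bilinear_value_kernel_variety:
  fixes T :: "'a::comm_ring_1 tensor"
  assumes "w \<in> kernel_variety n1 n2 n3 T"
  shows "bilinear_value n1 n2 n3 T z (\<lambda>a. w (Inl a)) (\<lambda>b. w (Inr b)) = 0"
proof -
  have slice: "(\<Sum>a<n1. \<Sum>b<n2. T a b c * w (Inl a) * w (Inr b)) = 0" if "c < n3" for c
  proof -
    have "(\<Sum>k<n3. T a b k * w (Inl a) * w (Inr b) * std_basis c k) = T a b c * w (Inl a) * w (Inr b)" for a b
    proof -
      have "(\<Sum>k<n3. T a b k * w (Inl a) * w (Inr b) * std_basis c k) =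
          (\<Sum>k<n3. if k = c then T a b k * w (Inl a) * w (Inr b) else 0)"
        by (intro sum.cong) (auto simp: std_basis_def)
      then show ?thesis
        using that by simp
    qed
    moreover have "tensor_form n1 n2 n3 T (w \<circ> Inl) (w \<circ> Inr) (std_basis c) = 0"
      using assms that by (simp add: kernel_variety_def)
    ultimately show ?thesis
      by (simp add: tensor_form_def)
  qed
  have "bilinear_value n1 n2 n3 T z (\<lambda>a. w (Inl a)) (\<lambda>b. w (Inr b)) =
      (\<Sum>a<n1. \<Sum>b<n2. \<Sum>c<n3. z c * (T a b c * w (Inl a) * w (Inr b)))"
    by (simp add: bilinear_value_def mult_ac)
  also have "\<dots> = (\<Sum>a<n1. \<Sum>c<n3. \<Sum>b<n2. z c * (T a b c * w (Inl a) * w (Inr b)))"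
    by (intro sum.cong refl sum.swap)
  also have "\<dots> = (\<Sum>c<n3. \<Sum>a<n1. \<Sum>b<n2. z c * (T a b c * w (Inl a) * w (Inr b)))"
    by (rule sum.swap)
  also have "\<dots> = (\<Sum>c<n3. z c * (\<Sum>a<n1. \<Sum>b<n2. T a b c * w (Inl a) * w (Inr b)))"
    by (simp only: sum_distrib_left)
  also have "\<dots> = 0"
    using slice by simp
  finally show ?thesis .
qed

lemma sum_swap_outer:
  "(\<Sum>i\<in>I. \<Sum>j\<in>J. \<Sum>a\<in>A. f i j a) = (\<Sum>a\<in>A. \<Sum>i\<in>I. \<Sum>j\<in>J. f i j a)"
proof -
  have "(\<Sum>i\<in>I. \<Sum>j\<in>J. \<Sum>a\<in>A. f i j a) = (\<Sum>i\<in>I. \<Sum>a\<in>A. \<Sum>j\<in>J. f i j a)"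
    by (intro sum.cong refl sum.swap)
  also have "\<dots> = (\<Sum>a\<in>A. \<Sum>i\<in>I. \<Sum>j\<in>J. f i j a)"
    by (rule sum.swap)
  finally show ?thesis .
qed

text \<open>Adjointness: acting on \<open>T\<close> amounts to substituting transposed matrices in
  the first two arguments and combining slices by row \<open>k\<close> of \<open>C\<close>.\<close>

lemma bilinear_value_tensor_action:
  fixes T :: "'a::comm_ring_1 tensor"
  shows "bilinear_value n1 n2 n3 T (C k) (\<lambda>a. \<Sum>i<n. u i * A i a) (\<lambda>b. \<Sum>j<n. v j * B j b) =
    (\<Sum>i<n. \<Sum>j<n. u i * v j * tensor_action n1 n2 n3 A B C T i j k)"
proof -
  have factor: "(\<Sum>i<n. \<Sum>j<n. u i * v j * (A i a * B j b * C k c * T a b c)) =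
      C k c * T a b c * ((\<Sum>i<n. u i * A i a) * (\<Sum>j<n. v j * B j b))" for a b c
    unfolding sum_product by (simp only: sum_distrib_left mult_ac)
  let ?f = "\<lambda>i j a b c. u i * v j * (A i a * B j b * C k c * T a b c)"
  have "(\<Sum>i<n. \<Sum>j<n. u i * v j * tensor_action n1 n2 n3 A B C T i j k) =
      (\<Sum>i<n. \<Sum>j<n. \<Sum>a<n1. \<Sum>b<n2. \<Sum>c<n3. ?f i j a b c)"
    by (simp only: tensor_action_def sum_distrib_left)
  also have "\<dots> = (\<Sum>a<n1. \<Sum>i<n. \<Sum>j<n. \<Sum>b<n2. \<Sum>c<n3. ?f i j a b c)"
    by (rule sum_swap_outer)
  also have "\<dots> = (\<Sum>a<n1. \<Sum>b<n2. \<Sum>i<n. \<Sum>j<n. \<Sum>c<n3. ?f i j a b c)"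
    by (intro sum.cong refl sum_swap_outer)
  also have "\<dots> = (\<Sum>a<n1. \<Sum>b<n2. \<Sum>c<n3. \<Sum>i<n. \<Sum>j<n. ?f i j a b c)"
    by (intro sum.cong refl sum_swap_outer)
  also have "\<dots> = bilinear_value n1 n2 n3 T (C k) (\<lambda>a. \<Sum>i<n. u i * A i a) (\<lambda>b. \<Sum>j<n. v j * B j b)"
    by (simp only: bilinear_value_def factor)
  finally show ?thesis ..
qed

text \<open>Both conclusions come from one choice of \<open>t\<close> and \<open>J\<close>. The
  first bounds the set whose maximum is the border subrank and keeps \<open>n1 + n2 - n\<close> from
  truncating.\<close>

lemma kernel_variety_chain_bound:
  fixes T :: "'a::alg_closed_field tensor"
  assumes deg: "degenerates n n n unit_tensor n1 n2 n3 T"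
  shows "n \<le> n1 + n2"
    and "\<And>d Z. (\<And>k. k \<le> d \<Longrightarrow> irreducible_closed ({..<n1} <+> {..<n2}) (Z k)) \<Longrightarrow>
      (\<And>k. k < d \<Longrightarrow> Z k \<subset> Z (Suc k)) \<Longrightarrow> Z d \<subseteq> kernel_variety n1 n2 n3 T \<Longrightarrow> d + n \<le> n1 + n2"
proof -
  define I where "I = {..<n1} <+> {..<n2}"
  have finI: "finite I" and cardI: "card I = n1 + n2"
    by (simp_all add: I_def card_Plus)
  obtain M and A B C :: "nat \<Rightarrow> nat \<Rightarrow> 'a poly" and R where
    act: "\<forall>t. \<forall>i<n. \<forall>j<n. \<forall>k<n.
      tensor_action n1 n2 n3 (\<lambda>i a. poly (A i a) t) (\<lambda>j b. poly (B j b) t) (\<lambda>k c. poly (C k c) t) T i j k =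
      t ^ M * (unit_tensor i j k + t * poly (R i j k) t)"
    by (rule degenerates_polynomial_family[OF deg]) (rule that)
  define W where "W = {xs. set xs \<subseteq> {..<n} \<and> length xs = Suc n}"
  obtain D :: "'a poly" and G key rest where D0: "poly D 0 = 1"
    and key: "\<forall>xs\<in>W. key xs < n"
    and rest: "\<forall>xs\<in>W. set (rest xs) \<subseteq> {..<n} \<and> Suc (length (rest xs)) = n"
    and words: "\<forall>t u \<delta>. (\<forall>k<n. u k ^ 2 + t * (\<Sum>i<n. \<Sum>j<n. poly (R i j k) t * u i * u j) = \<delta> k) \<longrightarrow>
      (\<forall>xs\<in>W. poly D t * word u xs =
        (\<Sum>ys\<in>W. poly (G xs ys) t * (\<delta> (key ys) * word u (rest ys))))"
    by (rule word_linear_system[of n R, folded W_def]) (rule that)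
  \<comment> \<open>Since \<open>poly D 0 = 1\<close>, the polynomial \<open>D\<close> has finitely
    many roots; 0 is excluded as well because \<open>t ^ M\<close> has to be inverted.\<close>
  have "finite ({t. poly D t = 0} \<union> {0})"
    using D0 poly_roots_finite[of D] by (cases "D = 0") auto
  then obtain t where t: "t \<noteq> 0" "poly D t \<noteq> 0"
    using ex_new_if_finite[OF infinite_UNIV_alg_closed_field] by blast
  define A' where "A' i a = poly (A i a) t" for i a
  define B' where "B' i b = poly (B i b) t" for i b
  define C' where "C' k c = poly (C k c) t" for k c
  define g where "g k = bilinear_value n1 n2 n3 T (C' k)" for k
  \<comment> \<open>Row \<open>i\<close> of \<open>A'\<close> followed by row \<open>i\<close> of
    \<open>B'\<close>: the image of the \<open>i\<close>-th unit vector under the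
    substitution.\<close>
  define E where "E i x = (case x of Inl a \<Rightarrow> if a < n1 then A' i a else 0
      | Inr b \<Rightarrow> if b < n2 then B' i b else 0)" for i x
  have g_diag: "g k (\<lambda>a. \<Sum>i<n. u i * A' i a) (\<lambda>b. \<Sum>j<n. u j * B' j b) =
      t ^ M * (u k ^ 2 + t * (\<Sum>i<n. \<Sum>j<n. poly (R i j k) t * u i * u j))" if "k < n" for k u
  proof -
    have "g k (\<lambda>a. \<Sum>i<n. u i * A' i a) (\<lambda>b. \<Sum>j<n. u j * B' j b) =
        (\<Sum>i<n. \<Sum>j<n. u i * u j * tensor_action n1 n2 n3 A' B' C' T i j k)"
      unfolding g_def by (rule bilinear_value_tensor_action)
    also have "\<dots> = (\<Sum>i<n. \<Sum>j<n. u i * u j * (t ^ M * (unit_tensor i j k + t * poly (R i j k) t)))"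
      using act that by (intro sum.cong refl) (simp add: A'_def[abs_def] B'_def[abs_def] C'_def[abs_def])
    also have "\<dots> = t ^ M * ((\<Sum>i<n. \<Sum>j<n. u i * u j * unit_tensor i j k) +
        t * (\<Sum>i<n. \<Sum>j<n. poly (R i j k) t * u i * u j))"
      by (simp only: sum_distrib_left sum.distrib[symmetric] ring_distribs mult_ac)
    also have "(\<Sum>i<n. \<Sum>j<n. u i * u j * unit_tensor i j k) =
        (\<Sum>i<n. \<Sum>j<n. if j = k then if i = k then u k ^ 2 else 0 else 0)"
      by (intro sum.cong refl) (auto simp: unit_tensor_def power2_eq_square)
    also have "\<dots> = u k ^ 2"
      using that by simp
    finally show ?thesis .
  qed
  have g_zero: "g k (\<lambda>a. 0) (\<lambda>b. 0) = 0" for k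
    by (simp add: g_def bilinear_value_def)
  have E_supp: "E i x = 0" if "i < n" "x \<notin> I" for i x
    using that(2) by (cases x) (auto simp: E_def I_def)
  have E_ind: "\<forall>i<n. u i = 0" if E0: "\<And>x. (\<Sum>i<n. u i * E i x) = 0" for u
  proof -
    have "(\<Sum>i<n. u i * A' i a) = 0" if "a < n1" for a
      using E0[of "Inl a"] that by (simp add: E_def)
    moreover have "(\<Sum>i<n. u i * B' i b) = 0" if "b < n2" for b
      using E0[of "Inr b"] that by (simp add: E_def)
    ultimately have "g k (\<lambda>a. \<Sum>i<n. u i * A' i a) (\<lambda>b. \<Sum>j<n. u j * B' j b) = g k (\<lambda>a. 0) (\<lambda>b. 0)" for k
      unfolding g_def by (intro bilinear_value_cong) auto
    then have rel: "u k ^ 2 + t * (\<Sum>i<n. \<Sum>j<n. poly (R i j k) t * u i * u j) = 0" if "k < n" for k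
      using g_diag[OF that, of u] g_zero t(1) by simp
    have "u k = 0" if "k < n" for k
    proof -
      \<comment> \<open>With \<open>\<delta> = 0\<close> the system kills every word of length
        \<open>n + 1\<close>, in particular the power \<open>u k ^ Suc n\<close>.\<close>
      have "poly D t * word u (replicate (Suc n) k) = 0"
        using words[rule_format, of u t "\<lambda>_. 0" "replicate (Suc n) k"] rel that by (simp add: W_def)
      then show ?thesis
        using t(2) by (auto simp: word_def prod_list_replicate)
    qed
    then show ?thesis
      by blast
  qed
  obtain J where J: "J \<subseteq> I" "card J + n \<le> card I"
    and decomp: "\<forall>w. \<exists>u l. \<forall>x\<in>I. w x = (\<Sum>i<n. u i * E i x) + (if x \<in> J then l x else 0)"
  proof (rule unit_vector_complement[of I n E])
    show "finite I"
      by (rule finI)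
    show "E i x = 0" if "i < n" "x \<notin> I" for i x
      using that by (rule E_supp)
    show "\<forall>i<n. u i = 0" if "\<And>x. (\<Sum>i<n. u i * E i x) = 0" for u
      using that by (rule E_ind)
  qed (rule that)
  from J cardI show "n \<le> n1 + n2"
    by simp

  define V where "V = kernel_variety n1 n2 n3 T"
  \<comment> \<open>A retraction onto \<open>V\<close>: composing with it turns relations that hold on \<open>V\<close> into identities of functions.\<close>
  define \<rho> where "\<rho> w = (if w \<in> V then w else restrict (\<lambda>_. 0) I)" for w :: "nat + nat \<Rightarrow> 'a"
  have "restrict (\<lambda>_. 0) I \<in> V"
    by (simp add: V_def kernel_variety_def affine_space_def I_def[symmetric] tensor_form_def)
       (auto simp: I_def intro!: sum.neutral)
  then have \<rho>_V: "\<rho> w \<in> V" for w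
    by (simp add: \<rho>_def)
  \<comment> \<open>Each retracted point is a combination of the \<open>E i\<close> plus a vector
    supported on \<open>J\<close>; the coefficients, chosen point by point, become the functions
    \<open>u\<close> and \<open>l\<close>.\<close>
  define splits where "splits w v m \<longleftrightarrow>
    (\<forall>x\<in>I. \<rho> w x = (\<Sum>i<n. v i * E i x) + (if x \<in> J then m x else 0))" for w v m
  have "\<forall>w. \<exists>v m. splits w v m"
    using decomp unfolding splits_def by simp
  then obtain u' l' where ul: "\<And>w. splits w (u' w) (l' w)"
    by metis
  define u where "u i w = u' w i" for i w
  define l where "l x w = l' w x" for x w
  have coord: "\<rho> w x = (\<Sum>i<n. E i x * u i w) + (if x \<in> J then l x w else 0)" if "x \<in> I" for w x
    using ul[of w] that by (simp add: splits_def u_def l_def mult.commute)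
  interpret word_module n u J l
    using J(1) finI by unfold_locales (rule finite_subset)
  define L where "L x w = (if x \<in> J then l x w else 0)" for x w
  define X where "X a w = (\<Sum>i<n. A' i a * u i w)" for a w
  define Y where "Y b w = (\<Sum>i<n. B' i b * u i w)" for b w
  \<comment> \<open>The remainder from \<open>bilinear_value_add\<close>: each summand contains one
    or two parameters \<open>L\<close>.\<close>
  define err where "err k w = (\<Sum>a<n1. \<Sum>b<n2. \<Sum>c<n3. C' k c * T a b c *
      (L (Inr b) w * X a w + L (Inl a) w * Y b w + L (Inl a) w * L (Inr b) w))" for k w
  have in_I: "a < n1 \<Longrightarrow> Inl a \<in> I" "b < n2 \<Longrightarrow> Inr b \<in> I" for a b
    by (auto simp: I_def)
  \<comment> \<open>On \<open>V\<close> the combination \<open>g k\<close> vanishes, so the quadric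
    equals the remainder up to a factor. This is the premise of \<open>words\<close>, with that
    multiple of the remainder as \<open>\<delta>\<close>.\<close>
  have relation: "u k w ^ 2 + t * (\<Sum>i<n. \<Sum>j<n. poly (R i j k) t * u i w * u j w) =
      - inverse (t ^ M) * err k w" if "k < n" for k w
  proof -
    have "0 = g k (\<lambda>a. \<rho> w (Inl a)) (\<lambda>b. \<rho> w (Inr b))"
      using bilinear_value_kernel_variety[OF \<rho>_V[of w, unfolded V_def]] by (simp add: g_def)
    also have "\<dots> = g k (\<lambda>a. X a w + L (Inl a) w) (\<lambda>b. Y b w + L (Inr b) w)"
      unfolding g_def
      by (intro bilinear_value_cong) (simp_all add: coord in_I E_def X_def Y_def L_def)
    also have "\<dots> = g k (\<lambda>a. X a w) (\<lambda>b. Y b w) + err k w"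
      unfolding g_def err_def by (rule bilinear_value_add)
    also have "g k (\<lambda>a. X a w) (\<lambda>b. Y b w) =
        t ^ M * (u k w ^ 2 + t * (\<Sum>i<n. \<Sum>j<n. poly (R i j k) t * u i w * u j w))"
      using g_diag[OF that, of "\<lambda>i. u i w"] by (simp add: X_def Y_def mult.commute)
    finally have eq: "t ^ M * (u k w ^ 2 + t * (\<Sum>i<n. \<Sum>j<n. poly (R i j k) t * u i w * u j w)) + err k w = 0"
      by (rule sym)
    have solve: "q = - inverse r * s" if "r * q + s = 0" "r \<noteq> 0" for q r s :: 'a
      using that by (simp add: field_simps eq_neg_iff_add_eq_0)
    show ?thesis
      by (rule solve[OF eq]) (use t(1) in simp)
  qed
  \<comment> \<open>A word of length \<open>n - 1\<close> absorbs the letter in \<open>X\<close> or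
    \<open>Y\<close> for free, so only the one or two factors \<open>L\<close> raise the level, to
    at most 2.\<close>
  have err_filt: "(\<lambda>w. err k w * word (\<lambda>i. u i w) s) \<in> filt 2"
    if s: "set s \<subseteq> {..<n}" "Suc (length s) = n" for k s
  proof -
    have L_filt: "(\<lambda>w. L x w * q w) \<in> filt (b + 1)" if "q \<in> filt b" for x q b
      unfolding L_def using that by (rule optional_parameter_mult_filt)
    have up: "f \<in> filt 2" if "f \<in> filt (0 + 1)" for f
      using that filt_mono[of "0 + 1" 2] by auto
    have lin: "(\<lambda>w. X a w * word (\<lambda>i. u i w) s) \<in> filt 0" "(\<lambda>w. Y a w * word (\<lambda>i. u i w) s) \<in> filt 0" for a
      unfolding X_def Y_def using s by (intro linear_mult_word_filt; simp)+
    have wd: "(\<lambda>w. word (\<lambda>i. u i w) s) \<in> filt 0"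
      using s by (intro word_in_filt) auto
    have "(\<lambda>w. L (Inr b) w * (X a w * word (\<lambda>i. u i w) s) + L (Inl a) w * (Y b w * word (\<lambda>i. u i w) s) +
        L (Inl a) w * (L (Inr b) w * word (\<lambda>i. u i w) s)) \<in> filt 2" for a b
      using L_filt[OF L_filt[OF wd]]
      by (intro filt_add up[OF L_filt[OF lin(1)]] up[OF L_filt[OF lin(2)]]) (simp add: numeral_2_eq_2)
    then have "(\<lambda>w. \<Sum>a<n1. \<Sum>b<n2. \<Sum>c<n3. C' k c * T a b c *
        (L (Inr b) w * (X a w * word (\<lambda>i. u i w) s) + L (Inl a) w * (Y b w * word (\<lambda>i. u i w) s) +
        L (Inl a) w * (L (Inr b) w * word (\<lambda>i. u i w) s))) \<in> filt 2"
      by (intro filt_sum filt_scale)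
    also have "(\<lambda>w. \<Sum>a<n1. \<Sum>b<n2. \<Sum>c<n3. C' k c * T a b c *
        (L (Inr b) w * (X a w * word (\<lambda>i. u i w) s) + L (Inl a) w * (Y b w * word (\<lambda>i. u i w) s) +
        L (Inl a) w * (L (Inr b) w * word (\<lambda>i. u i w) s))) = (\<lambda>w. err k w * word (\<lambda>i. u i w) s)"
      by (simp only: err_def sum_distrib_right ring_distribs mult.assoc)
    finally show ?thesis .
  qed
  \<comment> \<open>As \<open>poly D t\<close> is invertible, \<open>words\<close> expresses the
    word through remainders times words of length \<open>n - 1\<close>.\<close>
  have top: "(\<lambda>w. word (\<lambda>i. u i w) xs) \<in> filt 2" if xs: "set xs \<subseteq> {..<n}" "length xs = Suc n" for xs
  proof -
    have xsW: "xs \<in> W"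
      using xs by (simp add: W_def)
    have "word (\<lambda>i. u i w) xs = (\<Sum>ys\<in>W. (- inverse (poly D t) * poly (G xs ys) t * inverse (t ^ M)) *
        (err (key ys) w * word (\<lambda>i. u i w) (rest ys)))" for w
    proof -
      have "word (\<lambda>i. u i w) xs = inverse (poly D t) * (poly D t * word (\<lambda>i. u i w) xs)"
        using t(2) by simp
      also have "poly D t * word (\<lambda>i. u i w) xs = (\<Sum>ys\<in>W. poly (G xs ys) t *
          (- inverse (t ^ M) * err (key ys) w * word (\<lambda>i. u i w) (rest ys)))"
        by (rule words[rule_format, OF relation xsW])
      finally show ?thesis
        by (simp add: sum_distrib_left mult_ac)
    qed
    moreover have "(\<lambda>w. \<Sum>ys\<in>W. (- inverse (poly D t) * poly (G xs ys) t * inverse (t ^ M)) *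
        (err (key ys) w * word (\<lambda>i. u i w) (rest ys))) \<in> filt 2"
      using rest by (intro filt_sum filt_scale err_filt) auto
    ultimately show ?thesis
      by simp
  qed

  fix d and Z :: "nat \<Rightarrow> (nat + nat \<Rightarrow> 'a) set"
  assume Z: "\<And>k. k \<le> d \<Longrightarrow> irreducible_closed ({..<n1} <+> {..<n2}) (Z k)"
    "\<And>k. k < d \<Longrightarrow> Z k \<subset> Z (Suc k)" "Z d \<subseteq> kernel_variety n1 n2 n3 T"
  have "w \<in> range \<rho>" if "w \<in> Z d" for w
    using that Z(3) by (intro image_eqI[of _ _ w]) (auto simp: \<rho>_def V_def)
  then have "d \<le> card J"
    using Z(1,2) coord top
    by (intro chain_length_le[of I \<rho> d Z]) (auto simp: I_def)
  with J(2) cardI show "d + n \<le> n1 + n2"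
    by simp
qed

section \<open>From chains to the dimension and the border subrank\<close>

theorem theorem5p1:
  fixes T :: "'a::alg_closed_field tensor" and n1 n2 n3 :: nat
  shows "enat (border_subrank n1 n2 n3 T) \<le> geometric_rank n1 n2 n3 T"
proof -
  let ?S = "{n. degenerates n n n (unit_tensor :: 'a tensor) n1 n2 n3 T}"
  define n where "n = border_subrank n1 n2 n3 T"
  \<comment> \<open>The maximum is attained because the set is bounded and contains 0, where the
    degeneration condition is vacuous.\<close>
  have "?S \<subseteq> {..n1 + n2}"
    using kernel_variety_chain_bound(1) by blast
  then have "finite ?S"
    by (rule finite_subset) simp
  moreover have "0 \<in> ?S"
    by (simp add: degenerates_def)
  ultimately have deg: "degenerates n n n unit_tensor n1 n2 n3 T"
    using Max_in[of ?S] by (auto simp: n_def border_subrank_def)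
  have "variety_dim ({..<n1} <+> {..<n2}) (kernel_variety n1 n2 n3 T) \<le> enat (n1 + n2 - n)"
    unfolding variety_dim_def
  proof (rule Sup_least, clarify)
    fix d and Z :: "nat \<Rightarrow> (nat + nat \<Rightarrow> 'a) set"
    assume Z: "\<forall>k\<le>d. irreducible_closed ({..<n1} <+> {..<n2}) (Z k) \<and> Z k \<subseteq> kernel_variety n1 n2 n3 T"
      "\<forall>k<d. Z k \<subset> Z (Suc k)"
    have "d + n \<le> n1 + n2"
      using Z by (intro kernel_variety_chain_bound(2)[OF deg, of d Z]) auto
    then show "enat d \<le> enat (n1 + n2 - n)"
      by simp
  qed
  \<comment> \<open>Subtraction is antitone in the subtrahend; as \<open>n \<le> n1 + n2\<close>,
    the left side is \<open>n\<close>.\<close>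
  then have "enat (n1 + n2) - enat (n1 + n2 - n) \<le> geometric_rank n1 n2 n3 T"
    unfolding geometric_rank_def by (cases "variety_dim ({..<n1} <+> {..<n2}) (kernel_variety n1 n2 n3 T)") auto
  then show ?thesis
    using kernel_variety_chain_bound(1)[OF deg] by (simp add: n_def)
qed

end
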